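(* Let $R$ be a unital ring, let $e$ be an idempotent of $R$ and let $\phi\colon R\to eRe$ be a corner isomorphism (i.e. a ring isomorphism of $R$ onto the corner ring $eRe$). If $R$ is a von Neumann regular ring, then the corner skew Laurent polynomial ring $R[t_+,t_-;\phi]$ is semiprimitive and semiprime.
   Context: Rings are associative; a ring is called unital if it has a non-zero multiplicative identity. A ring $R$ is von Neumann regular if for every $x\in R$ there is $y\in R$ with $x=xyx$. A ring $S$ is semiprimitive if its Jacobson radical $J(S)$ is zero, and semiprime if for every $a\in S$, $aSa=\{0\}$ implies $a=0$. For a unital ring $R$, an idempotent $e\in R$ and a ring isomorphism $\phi\colon R\to eRe$ (so $\phi(1)=e$), the corner skew Laurent polynomial ring $R[t_+,t_-;\phi]$ is the unital ring generated by $R$ (as a unital subring) and two elements $t_+,t_-$ subject to the relations $t_-t_+=1$, $t_+t_-=e$, $t_+r=\phi(r)t_+$ and $rt_-=t_-\phi(r)$ for all $r\in R$. *)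

theory Defs
  imports "HOL-Algebra.QuotRing" "HOL-Library.Poly_Mapping"
begin

definition von_neumann_regular :: "('a, 'm) ring_scheme \<Rightarrow> bool" where
  "von_neumann_regular R \<longleftrightarrow>
     (\<forall>x \<in> carrier R. \<exists>y \<in> carrier R. x = x \<otimes>\<^bsub>R\<^esub> y \<otimes>\<^bsub>R\<^esub> x)"

definition semiprime_ring :: "('a, 'm) ring_scheme \<Rightarrow> bool" where
  "semiprime_ring S \<longleftrightarrow>
     (\<forall>a \<in> carrier S. (\<forall>s \<in> carrier S. a \<otimes>\<^bsub>S\<^esub> s \<otimes>\<^bsub>S\<^esub> a = \<zero>\<^bsub>S\<^esub>) \<longrightarrow> a = \<zero>\<^bsub>S\<^esub>)"

definition left_ideal :: "'a set \<Rightarrow> ('a, 'm) ring_scheme \<Rightarrow> bool" where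
  "left_ideal I S \<longleftrightarrow>
     additive_subgroup I S \<and> (\<forall>a \<in> I. \<forall>s \<in> carrier S. s \<otimes>\<^bsub>S\<^esub> a \<in> I)"

definition maximal_left_ideal :: "'a set \<Rightarrow> ('a, 'm) ring_scheme \<Rightarrow> bool" where
  "maximal_left_ideal M S \<longleftrightarrow>
     left_ideal M S \<and> M \<noteq> carrier S \<and>
     (\<forall>I. left_ideal I S \<longrightarrow> M \<subseteq> I \<longrightarrow> I = M \<or> I = carrier S)"

text \<open>For rings with an identity. The intersection with the carrier only matters if there are no
  maximal left ideals, i.e. for the zero ring.\<close>
definition jacobson_radical :: "('a, 'm) ring_scheme \<Rightarrow> 'a set" where
  "jacobson_radical S = carrier S \<inter> \<Inter> {M. maximal_left_ideal M S}"

definition semiprimitive_ring :: "('a, 'm) ring_scheme \<Rightarrow> bool" where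
  "semiprimitive_ring S \<longleftrightarrow> jacobson_radical S = {\<zero>\<^bsub>S\<^esub>}"

definition corner_ring :: "('a, 'm) ring_scheme \<Rightarrow> 'a \<Rightarrow> ('a, 'm) ring_scheme" where
  "corner_ring R e =
     R\<lparr>carrier := {e \<otimes>\<^bsub>R\<^esub> r \<otimes>\<^bsub>R\<^esub> e | r. r \<in> carrier R}, one := e\<rparr>"

text \<open>The free monoid on \<open>'x\<close>, written additively: the product of finitely supported functions
  on a \<^class>\<open>monoid_add\<close> is the convolution product, so that \<open>'x fmonoid \<Rightarrow>\<^sub>0 int\<close> is the free
  unital ring (noncommutative polynomials over the integers) on \<open>'x\<close>.\<close>
datatype 'x fmonoid = Word (letters: "'x list")

instantiation fmonoid :: (type) monoid_add
begin

definition zero_fmonoid :: "'a fmonoid" where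
  "0 = Word []"

definition plus_fmonoid :: "'a fmonoid \<Rightarrow> 'a fmonoid \<Rightarrow> 'a fmonoid" where
  "u + v = Word (letters u @ letters v)"

instance
  by standard (simp_all add: zero_fmonoid_def plus_fmonoid_def)

end

text \<open>The free unital ring on a set \<open>X\<close> of generators.\<close>
definition free_ring :: "'x set \<Rightarrow> ('x fmonoid \<Rightarrow>\<^sub>0 int) ring" where
  "free_ring X =
     \<lparr>carrier = {p. \<forall>w \<in> Poly_Mapping.keys p. set (letters w) \<subseteq> X},
      mult = (*), one = 1, zero = 0, add = (+)\<rparr>"

definition free_gen :: "'x \<Rightarrow> 'x fmonoid \<Rightarrow>\<^sub>0 int" where
  "free_gen x = Poly_Mapping.single (Word [x]) 1"

datatype 'a skew_gen = Coeff 'a | T_plus | T_minus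

definition skew_gens :: "('a, 'm) ring_scheme \<Rightarrow> 'a skew_gen set" where
  "skew_gens R = Coeff ` carrier R \<union> {T_plus, T_minus}"

text \<open>The first three families of relators make \<open>r \<mapsto> free_gen (Coeff r)\<close> a unital ring
  homomorphism modulo the relations; the others are the defining relations
  \<open>t\<^sub>- t\<^sub>+ = 1\<close>, \<open>t\<^sub>+ t\<^sub>- = e\<close>, \<open>t\<^sub>+ r = \<phi>(r) t\<^sub>+\<close> and \<open>r t\<^sub>- = t\<^sub>- \<phi>(r)\<close>.\<close>
definition skew_relators ::
    "('a, 'm) ring_scheme \<Rightarrow> 'a \<Rightarrow> ('a \<Rightarrow> 'a) \<Rightarrow> ('a skew_gen fmonoid \<Rightarrow>\<^sub>0 int) set" where
  "skew_relators R e \<phi> =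
     (let c = (\<lambda>r. free_gen (Coeff r)); tp = free_gen T_plus; tm = free_gen T_minus in
        {c (a \<oplus>\<^bsub>R\<^esub> b) - (c a + c b) | a b. a \<in> carrier R \<and> b \<in> carrier R}
      \<union> {c (a \<otimes>\<^bsub>R\<^esub> b) - c a * c b | a b. a \<in> carrier R \<and> b \<in> carrier R}
      \<union> {c \<one>\<^bsub>R\<^esub> - 1}
      \<union> {tm * tp - 1, tp * tm - c e}
      \<union> {tp * c r - c (\<phi> r) * tp | r. r \<in> carrier R}
      \<union> {c r * tm - tm * c (\<phi> r) | r. r \<in> carrier R})"

definition corner_skew_laurent ::
    "('a, 'm) ring_scheme \<Rightarrow> 'a \<Rightarrow> ('a \<Rightarrow> 'a) \<Rightarrow> ('a skew_gen fmonoid \<Rightarrow>\<^sub>0 int) set ring" where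
  "corner_skew_laurent R e \<phi> =
     free_ring (skew_gens R) Quot (genideal (free_ring (skew_gens R)) (skew_relators R e \<phi>))"

lemma ring_corner_ring:
  assumes "ring R" and e: "e \<in> carrier R" "e \<otimes>\<^bsub>R\<^esub> e = e"
  shows "ring (corner_ring R e)"
proof -
  interpret ring R by fact
  let ?E = "{e \<otimes>\<^bsub>R\<^esub> r \<otimes>\<^bsub>R\<^esub> e | r. r \<in> carrier R}"
  have mem: "x \<in> ?E \<longleftrightarrow> x \<in> carrier R \<and> e \<otimes>\<^bsub>R\<^esub> x = x \<and> x \<otimes>\<^bsub>R\<^esub> e = x" for x
  proof
    assume "x \<in> ?E"
    then obtain r where r: "r \<in> carrier R" "x = e \<otimes>\<^bsub>R\<^esub> r \<otimes>\<^bsub>R\<^esub> e" by blast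
    have "e \<otimes>\<^bsub>R\<^esub> x = (e \<otimes>\<^bsub>R\<^esub> e) \<otimes>\<^bsub>R\<^esub> r \<otimes>\<^bsub>R\<^esub> e" using r e(1) by (simp add: m_assoc)
    moreover have "x \<otimes>\<^bsub>R\<^esub> e = e \<otimes>\<^bsub>R\<^esub> r \<otimes>\<^bsub>R\<^esub> (e \<otimes>\<^bsub>R\<^esub> e)"
      using r e(1) by (simp add: m_assoc)
    ultimately show "x \<in> carrier R \<and> e \<otimes>\<^bsub>R\<^esub> x = x \<and> x \<otimes>\<^bsub>R\<^esub> e = x" using r e by simp
  next
    assume x: "x \<in> carrier R \<and> e \<otimes>\<^bsub>R\<^esub> x = x \<and> x \<otimes>\<^bsub>R\<^esub> e = x"
    then have "x = e \<otimes>\<^bsub>R\<^esub> x \<otimes>\<^bsub>R\<^esub> e" by simp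
    with x show "x \<in> ?E" by blast
  qed
  have eq: "corner_ring R e =
      R\<lparr>carrier := {x \<in> carrier R. e \<otimes>\<^bsub>R\<^esub> x = x \<and> x \<otimes>\<^bsub>R\<^esub> e = x}, one := e\<rparr>"
  proof -
    have "?E = {x \<in> carrier R. e \<otimes>\<^bsub>R\<^esub> x = x \<and> x \<otimes>\<^bsub>R\<^esub> e = x}"
      using mem by (intro Set.set_eqI) (simp only: mem_Collect_eq)
    then show ?thesis by (simp only: corner_ring_def)
  qed
  have left: "e \<otimes>\<^bsub>R\<^esub> (x \<otimes>\<^bsub>R\<^esub> y) = x \<otimes>\<^bsub>R\<^esub> y"
    if "x \<in> carrier R" "y \<in> carrier R" "e \<otimes>\<^bsub>R\<^esub> x = x" for x y
    using that e(1) by (metis m_assoc)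
  show ?thesis
    unfolding eq
  proof (intro ringI abelian_groupI monoidI, simp_all)
    fix x assume "x \<in> carrier R \<and> e \<otimes>\<^bsub>R\<^esub> x = x \<and> x \<otimes>\<^bsub>R\<^esub> e = x"
    then show "\<exists>y. y \<in> carrier R \<and> e \<otimes>\<^bsub>R\<^esub> y = y \<and> y \<otimes>\<^bsub>R\<^esub> e = y \<and> y \<oplus>\<^bsub>R\<^esub> x = \<zero>\<^bsub>R\<^esub>"
      using e(1) by (intro exI[of _ "\<ominus>\<^bsub>R\<^esub> x"]) (simp add: r_minus l_minus l_neg)
  qed (use e in \<open>simp_all add: a_ac m_assoc l_distr r_distr left\<close>)
qed

lemma ring_free_ring: "ring (free_ring X)"
proof -
  let ?C = "{p :: 'a fmonoid \<Rightarrow>\<^sub>0 int. \<forall>w \<in> Poly_Mapping.keys p. set (letters w) \<subseteq> X}"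
  have add: "p + q \<in> ?C" if "p \<in> ?C" "q \<in> ?C" for p q
    using that Poly_Mapping.keys_add[of p q] by blast
  have mult: "p * q \<in> ?C" if "p \<in> ?C" "q \<in> ?C" for p q
  proof (standard, standard)
    fix w assume "w \<in> Poly_Mapping.keys (p * q)"
    then obtain u v where "w = u + v" "u \<in> Poly_Mapping.keys p" "v \<in> Poly_Mapping.keys q"
      using keys_mult[of p q] by blast
    with that show "set (letters w) \<subseteq> X" by (simp add: plus_fmonoid_def)
  qed
  have neg: "\<exists>q \<in> ?C. q + p = 0" if "p \<in> ?C" for p
    using that by (intro bexI[of _ "- p"]) simp_all
  have const: "0 \<in> ?C" "1 \<in> ?C" by (simp_all add: zero_fmonoid_def)
  have sel: "carrier (free_ring X) = ?C" "p \<otimes>\<^bsub>free_ring X\<^esub> q = p * q" "p \<oplus>\<^bsub>free_ring X\<^esub> q = p + q"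
    "\<zero>\<^bsub>free_ring X\<^esub> = 0" "\<one>\<^bsub>free_ring X\<^esub> = 1" for p q
    by (simp_all add: free_ring_def)
  show ?thesis
    by (intro ringI abelian_groupI monoidI; unfold sel)
      (fact add mult neg const | simp only: algebra_simps mult_1_left mult_1_right add_0_left add_0_right)+
qed

lemma free_gen_closed: "x \<in> X \<Longrightarrow> free_gen x \<in> carrier (free_ring X)"
  by (simp add: free_gen_def free_ring_def)

lemma skew_relators_closed:
  assumes "ring R" "e \<in> carrier R" "\<phi> \<in> carrier R \<rightarrow> carrier R"
  shows "skew_relators R e \<phi> \<subseteq> carrier (free_ring (skew_gens R))"
proof -
  interpret R: ring R by fact
  let ?F = "free_ring (skew_gens R)"
  interpret F: ring ?F by (rule ring_free_ring)
  have add: "p + q \<in> carrier ?F" and mult: "p * q \<in> carrier ?F"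
    if "p \<in> carrier ?F" "q \<in> carrier ?F" for p q
    using that F.a_closed[of p q] F.m_closed[of p q] by (simp_all add: free_ring_def)
  have diff: "p - q \<in> carrier ?F" if "p \<in> carrier ?F" "q \<in> carrier ?F" for p q
    using that add[of p "- q"] by (simp add: free_ring_def)
  have one: "1 \<in> carrier ?F" using F.one_closed by (simp add: free_ring_def)
  have c: "free_gen (Coeff r) \<in> carrier ?F" if "r \<in> carrier R" for r
    using that by (intro free_gen_closed) (simp add: skew_gens_def)
  have t: "free_gen T_plus \<in> carrier ?F" "free_gen T_minus \<in> carrier ?F"
    by (intro free_gen_closed; simp add: skew_gens_def)+
  have phi: "\<phi> r \<in> carrier R" if "r \<in> carrier R" for r using assms(3) that by blast
  show ?thesis
    unfolding skew_relators_def Let_def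
    using assms(2) by (auto intro!: diff add mult one c t phi)
qed

lemma ring_corner_skew_laurent:
  assumes "ring R" "e \<in> carrier R" "\<phi> \<in> carrier R \<rightarrow> carrier R"
  shows "ring (corner_skew_laurent R e \<phi>)"
  unfolding corner_skew_laurent_def
  by (intro ideal.quotient_is_ring ring.genideal_ideal ring_free_ring skew_relators_closed assms)

end

theory Submission
  imports Defs
begin

text \<open>The ring \<open>R[t\<^sub>+, t\<^sub>-; \<phi>]\<close> is \<open>\<int>\<close>-graded because its relations are homogeneous, and its
  component of degree \<open>n\<close> is \<open>R t\<^sub>+\<^sup>n\<close> or \<open>t\<^sub>-\<^sup>-\<^sup>n R\<close>; regularity of \<open>R\<close> therefore makes it graded
  regular: every homogeneous \<open>x\<close> satisfies \<open>x y x = x\<close> for a homogeneous \<open>y\<close>.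
  A graded regular ring has zero Jacobson radical \<open>J\<close>. Otherwise take a nonzero element of \<open>J\<close> with
  the least number of homogeneous components. Multiplying by homogeneous elements turns it into an
  \<open>x\<close> whose top component is an idempotent \<open>f \<noteq> 0\<close> of degree \<open>0\<close>, with \<open>x = f x f\<close>. By minimality
  \<open>x\<close> commutes with all homogeneous elements of the corner of \<open>f\<close>, so its lowest component \<open>c\<close> is
  central there, and regularity gives an idempotent \<open>g \<noteq> 0\<close> and a homogeneous \<open>b\<close> with
  \<open>c b = b c = g\<close>. If \<open>c\<close> has degree \<open>-l < 0\<close>, then \<open>g - x b\<^sup>2\<close> has lowest component \<open>g\<close> in degree \<open>0\<close> and
  the invertible top component \<open>- b\<^sup>2\<close> in degree \<open>2 l\<close>, so comparing degrees shows that it has no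
  left inverse, although \<open>x b\<^sup>2\<close> lies in \<open>J\<close>. If \<open>l = 0\<close>, then \<open>x = f\<close> is an idempotent of \<open>J\<close>.\<close>

section \<open>The Jacobson radical\<close>

context ring
begin

section \<open>Left ideals and maximal left ideals\<close>

lemma left_idealI:
  assumes "I \<subseteq> carrier R" "\<zero> \<in> I"
    and "\<And>a b. a \<in> I \<Longrightarrow> b \<in> I \<Longrightarrow> a \<oplus> b \<in> I"
    and mult: "\<And>a s. a \<in> I \<Longrightarrow> s \<in> carrier R \<Longrightarrow> s \<otimes> a \<in> I"
  shows "left_ideal I R"
proof -
  have "\<ominus> a \<in> I" if "a \<in> I" for a
    using mult[OF that, of "\<ominus> \<one>"] subsetD[OF assms(1) that] by (simp add: l_minus)
  then have "subgroup I (add_monoid R)"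
    using assms by (intro add.subgroupI) auto
  then show ?thesis
    using mult by (simp add: left_ideal_def additive_subgroup_def)
qed

lemma left_idealD:
  assumes "left_ideal I R"
  shows "I \<subseteq> carrier R" "\<zero> \<in> I" "a \<in> I \<Longrightarrow> b \<in> I \<Longrightarrow> a \<oplus> b \<in> I"
    "a \<in> I \<Longrightarrow> s \<in> carrier R \<Longrightarrow> s \<otimes> a \<in> I"
  using assms additive_subgroup.a_subset[of I R] additive_subgroup.zero_closed[of I R]
    additive_subgroup.a_closed[of I R]
  by (simp_all add: left_ideal_def)

lemma left_ideal_one:
  assumes "left_ideal I R" "\<one> \<in> I"
  shows "I = carrier R"
  using left_idealD(1)[OF assms(1)] left_idealD(4)[OF assms] by auto

text \<open>Zorn's lemma is applied to the left ideals above \<open>I\<close> that avoid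
  \<open>\<one>\<close>; the union of a chain of these avoids \<open>\<one>\<close> too. A maximal
  member is a maximal left ideal of the ring because every strictly larger left ideal contains
  \<open>\<one>\<close>, hence everything.\<close>

lemma left_ideal_maximal_ext:
  assumes I: "left_ideal I R" "\<one> \<notin> I"
  obtains M where "maximal_left_ideal M R" "I \<subseteq> M"
proof -
  define A where "A = {K. left_ideal K R \<and> I \<subseteq> K \<and> \<one> \<notin> K}"
  have "\<exists>M\<in>A. \<forall>X\<in>A. M \<subseteq> X \<longrightarrow> X = M"
  proof (rule subset_Zorn_nonempty)
    show "A \<noteq> {}" using I by (auto simp: A_def)
    fix C assume C: "C \<noteq> {}" "subset.chain A C"
    then have lin: "K \<subseteq> L \<or> L \<subseteq> K" if "K \<in> C" "L \<in> C" for K L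
      using that unfolding subset_chain_def by blast
    have mem: "left_ideal K R" "I \<subseteq> K" "\<one> \<notin> K" if "K \<in> C" for K
      using that C(2) unfolding subset_chain_def A_def by blast+
    have "left_ideal (\<Union>C) R"
    proof (rule left_idealI)
      show "\<Union>C \<subseteq> carrier R" using left_idealD(1)[OF mem(1)] by (rule Union_least)
      obtain K where "K \<in> C" using C(1) by blast
      then show "\<zero> \<in> \<Union>C" using left_idealD(2)[OF mem(1)] by blast
    next
      fix a b assume "a \<in> \<Union>C" "b \<in> \<Union>C"
      then obtain K L where KL: "K \<in> C" "a \<in> K" "L \<in> C" "b \<in> L" by blast
      have "a \<oplus> b \<in> K \<or> a \<oplus> b \<in> L"
        using lin[OF KL(1,3)] left_idealD(3)[OF mem(1)[OF KL(1)], of a b]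
          left_idealD(3)[OF mem(1)[OF KL(3)], of a b] KL(2,4) by blast
      then show "a \<oplus> b \<in> \<Union>C" using KL(1,3) by blast
    next
      fix a s assume "a \<in> \<Union>C" and s: "s \<in> carrier R"
      then obtain K where "K \<in> C" "a \<in> K" by blast
      then show "s \<otimes> a \<in> \<Union>C" using left_idealD(4)[OF mem(1) _ s, of K a] by blast
    qed
    then show "\<Union>C \<in> A" using mem C(1) unfolding A_def by blast
  qed
  then obtain M where M: "M \<in> A" and max: "\<And>X. X \<in> A \<Longrightarrow> M \<subseteq> X \<Longrightarrow> X = M"
    by (elim bexE) simp
  have "maximal_left_ideal M R"
    unfolding maximal_left_ideal_def
  proof (intro conjI allI impI)
    show "left_ideal M R" "M \<noteq> carrier R" using M by (auto simp: A_def)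
    fix K assume K: "left_ideal K R" "M \<subseteq> K"
    show "K = M \<or> K = carrier R"
    proof (cases "\<one> \<in> K")
      case True
      then show ?thesis using left_ideal_one[OF K(1)] by simp
    next
      case False
      then have "K \<in> A" using K M by (auto simp: A_def)
      then show ?thesis using max K(2) by simp
    qed
  qed
  then show thesis using that M by (simp add: A_def)
qed

text \<open>The left ideal \<open>M + R x\<close> is strictly larger than \<open>M\<close>, so it is
  the whole ring. This is the form in which maximality is used below.\<close>

lemma maximal_left_ideal_comaximal:
  assumes M: "maximal_left_ideal M R" and x: "x \<in> carrier R" "x \<notin> M"
  obtains m s where "m \<in> M" "s \<in> carrier R" "m \<oplus> s \<otimes> x = \<one>"
proof -
  have lM: "left_ideal M R" using M by (simp add: maximal_left_ideal_def)
  note D = left_idealD[OF lM]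
  let ?K = "{m \<oplus> s \<otimes> x | m s. m \<in> M \<and> s \<in> carrier R}"
  have "left_ideal ?K R"
  proof (rule left_idealI)
    show "?K \<subseteq> carrier R" using D(1) x(1) by auto
    have "\<zero> = \<zero> \<oplus> \<zero> \<otimes> x" using x(1) by simp
    then show "\<zero> \<in> ?K" using D(2) by blast
  next
    fix a b assume "a \<in> ?K" "b \<in> ?K"
    then obtain m s n t where *: "a = m \<oplus> s \<otimes> x" "b = n \<oplus> t \<otimes> x" "m \<in> M" "n \<in> M"
      "s \<in> carrier R" "t \<in> carrier R" by blast
    then have "a \<oplus> b = (m \<oplus> n) \<oplus> (s \<oplus> t) \<otimes> x"
      using D(1) x(1) by (auto simp: subset_iff l_distr a_ac)
    then show "a \<oplus> b \<in> ?K" using * D(3) by blast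
  next
    fix a r assume "a \<in> ?K" and r: "r \<in> carrier R"
    then obtain m s where *: "a = m \<oplus> s \<otimes> x" "m \<in> M" "s \<in> carrier R" by blast
    then have "r \<otimes> a = r \<otimes> m \<oplus> (r \<otimes> s) \<otimes> x"
      using D(1) x(1) r by (auto simp: subset_iff r_distr m_assoc)
    then show "r \<otimes> a \<in> ?K" using * r D(4) by blast
  qed
  moreover have "M \<subseteq> ?K"
  proof
    fix m assume "m \<in> M"
    then have "m = m \<oplus> \<zero> \<otimes> x" using D(1) x(1) by auto
    then show "m \<in> ?K" using \<open>m \<in> M\<close> by blast
  qed
  moreover have "x = \<zero> \<oplus> \<one> \<otimes> x" using x(1) by simp
  then have "x \<in> ?K" using D(2) by blast
  ultimately have "?K = carrier R"
    using M x(2) unfolding maximal_left_ideal_def by blast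
  then have "\<one> \<in> ?K" by simp
  then show thesis using that by force
qed

section \<open>The intersection of the maximal left ideals\<close>

lemma jacobson_radical_closed: "x \<in> jacobson_radical R \<Longrightarrow> x \<in> carrier R"
  by (simp add: jacobson_radical_def)

lemma left_ideal_jacobson_radical: "left_ideal (jacobson_radical R) R"
  by (rule left_idealI) (auto simp: jacobson_radical_def maximal_left_ideal_def left_idealD)

text \<open>If the left ideal generated by \<open>\<one> \<ominus> x\<close> were proper, it would
  lie in a maximal left ideal, which also contains \<open>x\<close> and therefore the sum
  \<open>\<one>\<close>.\<close>

lemma jacobson_radical_quasi_regular:
  assumes x: "x \<in> jacobson_radical R"
  obtains u where "u \<in> carrier R" "u \<otimes> (\<one> \<ominus> x) = \<one>"
proof -
  let ?L = "{u \<otimes> (\<one> \<ominus> x) | u. u \<in> carrier R}"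
  have xc: "x \<in> carrier R" using x by (rule jacobson_radical_closed)
  have L: "left_ideal ?L R"
  proof (rule left_idealI)
    show "?L \<subseteq> carrier R" using xc by auto
    have "\<zero> = \<zero> \<otimes> (\<one> \<ominus> x)" using xc by simp
    then show "\<zero> \<in> ?L" by blast
  next
    fix a b assume "a \<in> ?L" "b \<in> ?L"
    then obtain u v where *: "u \<in> carrier R" "a = u \<otimes> (\<one> \<ominus> x)" "v \<in> carrier R" "b = v \<otimes> (\<one> \<ominus> x)"
      by blast
    then have "a \<oplus> b = (u \<oplus> v) \<otimes> (\<one> \<ominus> x)" using xc by (simp add: l_distr)
    then show "a \<oplus> b \<in> ?L" using * by blast
  next
    fix a s assume "a \<in> ?L" "s \<in> carrier R"
    then obtain u where *: "u \<in> carrier R" "a = u \<otimes> (\<one> \<ominus> x)" by blast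
    then have "s \<otimes> a = (s \<otimes> u) \<otimes> (\<one> \<ominus> x)" using xc \<open>s \<in> carrier R\<close> by (simp add: m_assoc)
    then show "s \<otimes> a \<in> ?L" using * \<open>s \<in> carrier R\<close> by blast
  qed
  have "\<one> \<in> ?L"
  proof (rule ccontr)
    assume "\<one> \<notin> ?L"
    then obtain M where M: "maximal_left_ideal M R" "?L \<subseteq> M"
      using left_ideal_maximal_ext[OF L] by blast
    then have lM: "left_ideal M R" and ne: "M \<noteq> carrier R" by (auto simp: maximal_left_ideal_def)
    have "\<one> \<ominus> x = \<one> \<otimes> (\<one> \<ominus> x)" using xc by simp
    then have "\<one> \<ominus> x \<in> M" using M(2) by blast
    moreover have "x \<in> M" using x M(1) by (auto simp: jacobson_radical_def)
    ultimately have "(\<one> \<ominus> x) \<oplus> x \<in> M" using left_idealD(3)[OF lM] by blast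
    moreover have "(\<one> \<ominus> x) \<oplus> x = \<one>" using xc by (simp add: minus_eq a_assoc l_neg)
    ultimately show False using left_ideal_one[OF lM] ne by simp
  qed
  then show thesis using that by force
qed

text \<open>The radical is an intersection of left ideals, so closure on the right is not automatic.
  If a maximal left ideal \<open>M\<close> misses \<open>x r\<close>, then
  \<open>1 = m + s x r\<close> with \<open>m\<close> in \<open>M\<close>, whence
  \<open>r m = (1 - r s x) r\<close>. The factor \<open>1 - r s x\<close> is left invertible because
  \<open>r s x\<close> lies in the radical, so \<open>r\<close>, and with it \<open>x r\<close>,
  would be in \<open>M\<close>.\<close>

lemma jacobson_radical_mult_right:
  assumes x: "x \<in> jacobson_radical R" and r: "r \<in> carrier R"
  shows "x \<otimes> r \<in> jacobson_radical R"
proof -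
  have xc: "x \<in> carrier R" using x by (rule jacobson_radical_closed)
  have "x \<otimes> r \<in> M" if M: "maximal_left_ideal M R" for M
  proof (rule ccontr)
    have lM: "left_ideal M R" using M by (simp add: maximal_left_ideal_def)
    assume no: "x \<otimes> r \<notin> M"
    obtain m s where m: "m \<in> M" "s \<in> carrier R" "m \<oplus> s \<otimes> (x \<otimes> r) = \<one>"
      using maximal_left_ideal_comaximal[OF M _ no] xc r by blast
    have mc: "m \<in> carrier R" using m(1) left_idealD(1)[OF lM] by blast
    have "r \<otimes> s \<otimes> x \<in> jacobson_radical R"
      using left_idealD(4)[OF left_ideal_jacobson_radical x, of "r \<otimes> s"] r m(2) by simp
    then obtain u where u: "u \<in> carrier R" "u \<otimes> (\<one> \<ominus> r \<otimes> s \<otimes> x) = \<one>"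
      using jacobson_radical_quasi_regular by blast
    have "m = (m \<oplus> s \<otimes> (x \<otimes> r)) \<ominus> s \<otimes> (x \<otimes> r)"
      using m(2) mc xc r by (simp add: minus_eq a_assoc r_neg)
    then have "m = \<one> \<ominus> s \<otimes> (x \<otimes> r)" using m(3) by simp
    then have "r \<otimes> m = r \<ominus> r \<otimes> (s \<otimes> (x \<otimes> r))"
      using m(2) xc r by (simp add: minus_eq r_distr r_minus)
    also have "\<dots> = (\<one> \<ominus> r \<otimes> s \<otimes> x) \<otimes> r"
      using m(2) xc r by (simp add: minus_eq l_distr l_minus m_assoc)
    finally have "u \<otimes> r \<otimes> m = (u \<otimes> (\<one> \<ominus> r \<otimes> s \<otimes> x)) \<otimes> r"
      using m(2) xc r u(1) mc by (simp add: m_assoc)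
    then have "u \<otimes> r \<otimes> m = r" using u r by simp
    then have "r \<in> M" using left_idealD(4)[OF lM m(1), of "u \<otimes> r"] u(1) r by simp
    then show False using no left_idealD(4)[OF lM] xc by blast
  qed
  then show ?thesis using xc r by (auto simp: jacobson_radical_def)
qed

text \<open>An element \<open>a\<close> with \<open>a R a = 0\<close> lies in every maximal left
  ideal \<open>M\<close>: otherwise \<open>m + s a = 1\<close> with \<open>m\<close> in
  \<open>M\<close>, and multiplying by \<open>a\<close> on the left gives \<open>a = a m\<close>, an
  element of \<open>M\<close>.\<close>

lemma semiprime_if_semiprimitive:
  assumes "semiprimitive_ring R"
  shows "semiprime_ring R"
  unfolding semiprime_ring_def
proof (intro ballI impI)
  fix a assume a: "a \<in> carrier R" "\<forall>s\<in>carrier R. a \<otimes> s \<otimes> a = \<zero>"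
  have "a \<in> M" if M: "maximal_left_ideal M R" for M
  proof (rule ccontr)
    assume "a \<notin> M"
    then obtain m s where m: "m \<in> M" "s \<in> carrier R" "m \<oplus> s \<otimes> a = \<one>"
      using maximal_left_ideal_comaximal[OF M a(1)] by blast
    have lM: "left_ideal M R" using M by (simp add: maximal_left_ideal_def)
    have "m \<in> carrier R" using m(1) left_idealD(1)[OF lM] by blast
    then have "a \<otimes> (m \<oplus> s \<otimes> a) = a \<otimes> m" using a m(2) by (simp add: r_distr flip: m_assoc)
    then have "a = a \<otimes> m" using m(3) a(1) by simp
    then show False using \<open>a \<notin> M\<close> left_idealD(4)[OF lM m(1) a(1)] by simp
  qed
  then have "a \<in> jacobson_radical R" using a(1) by (auto simp: jacobson_radical_def)
  then show "a = \<zero>" using assms by (simp add: semiprimitive_ring_def)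
qed

end

text \<open>The element \<open>\<one> \<ominus> f\<close> is left invertible, yet
  \<open>(\<one> \<ominus> f) \<otimes> f = \<zero>\<close>.\<close>

lemma (in ring) jacobson_radical_idempotent:
  assumes "f \<in> jacobson_radical R" "f \<otimes> f = f"
  shows "f = \<zero>"
proof -
  have f: "f \<in> carrier R" using assms(1) by (rule jacobson_radical_closed)
  obtain u where u: "u \<in> carrier R" "u \<otimes> (\<one> \<ominus> f) = \<one>"
    using jacobson_radical_quasi_regular[OF assms(1)] .
  have "f = (u \<otimes> (\<one> \<ominus> f)) \<otimes> f" using u f by simp
  also have "\<dots> = u \<otimes> (f \<ominus> f \<otimes> f)" using u(1) f by (simp add: m_assoc minus_eq l_distr l_minus)
  also have "\<dots> = \<zero>" using assms(2) u(1) f by (simp add: minus_eq r_neg)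
  finally show ?thesis .
qed

lemma (in ring) eq_if_diff_zero:
  assumes "x \<in> carrier R" "y \<in> carrier R" "x \<ominus> y = \<zero>"
  shows "x = y"
proof -
  have "\<ominus> (\<ominus> y) = x"
    using assms by - (rule minus_equality, simp_all add: minus_eq)
  then show ?thesis using assms(2) by simp
qed

section \<open>Graded regular rings\<close>

text \<open>The grading is given by its projections instead of a family of subgroups. With
  \<open>finite_support\<close> and \<open>component_eq_zero\<close> every element is the finite sum
  of its components; the last two laws say that multiplication by a homogeneous element shifts
  degrees.\<close>

locale graded_ring = ring +
  fixes \<pi> :: "int \<Rightarrow> 'a \<Rightarrow> 'a"
  assumes component_closed [simp, intro]: "x \<in> carrier R \<Longrightarrow> \<pi> n x \<in> carrier R"
    and component_add: "x \<in> carrier R \<Longrightarrow> y \<in> carrier R \<Longrightarrow> \<pi> n (x \<oplus> y) = \<pi> n x \<oplus> \<pi> n y"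
    and component_component: "x \<in> carrier R \<Longrightarrow> \<pi> m (\<pi> n x) = (if m = n then \<pi> n x else \<zero>)"
    and finite_support: "x \<in> carrier R \<Longrightarrow> finite {n. \<pi> n x \<noteq> \<zero>}"
    and component_eq_zero: "x \<in> carrier R \<Longrightarrow> (\<And>n. \<pi> n x = \<zero>) \<Longrightarrow> x = \<zero>"
    and component_mult_left: "x \<in> carrier R \<Longrightarrow> y \<in> carrier R \<Longrightarrow> \<pi> n (\<pi> d x \<otimes> y) = \<pi> d x \<otimes> \<pi> (n - d) y"
    and component_mult_right: "x \<in> carrier R \<Longrightarrow> y \<in> carrier R \<Longrightarrow> \<pi> n (x \<otimes> \<pi> d y) = \<pi> (n - d) x \<otimes> \<pi> d y"
begin

section \<open>Homogeneous elements and sums of components\<close>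

definition support :: "'a \<Rightarrow> int set" where
  "support x = {n. \<pi> n x \<noteq> \<zero>}"

definition homogeneous :: "int \<Rightarrow> 'a \<Rightarrow> bool" where
  "homogeneous d x \<longleftrightarrow> x \<in> carrier R \<and> \<pi> d x = x"

lemma component_zero [simp]: "\<pi> n \<zero> = \<zero>"
  using component_add[of \<zero> \<zero> n] by (simp add: add.r_cancel_one)

lemma component_minus: "x \<in> carrier R \<Longrightarrow> \<pi> n (\<ominus> x) = \<ominus> \<pi> n x"
  using component_add[of "\<ominus> x" x n] by - (rule minus_equality[symmetric], simp_all add: l_neg)

lemma component_diff:
  "x \<in> carrier R \<Longrightarrow> y \<in> carrier R \<Longrightarrow> \<pi> n (x \<ominus> y) = \<pi> n x \<ominus> \<pi> n y"
  by (simp add: minus_eq component_add component_minus)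

lemma component_ext:
  assumes "x \<in> carrier R" "y \<in> carrier R" "\<And>n. \<pi> n x = \<pi> n y"
  shows "x = y"
proof -
  have "x \<ominus> y = \<zero>"
    using assms by - (rule component_eq_zero, simp_all add: component_diff, simp add: minus_eq r_neg)
  then show ?thesis using assms(1,2) eq_if_diff_zero by blast
qed

lemma homogeneous_carrier: "homogeneous d x \<Longrightarrow> x \<in> carrier R"
  by (simp add: homogeneous_def)

lemma homogeneous_component: "x \<in> carrier R \<Longrightarrow> homogeneous d (\<pi> d x)"
  by (simp add: homogeneous_def component_component)

lemma component_homogeneous: "homogeneous d x \<Longrightarrow> \<pi> n x = (if n = d then x else \<zero>)"
  using component_component[of x n d] by (simp add: homogeneous_def)

lemma component_homogeneous_mult:
  assumes "homogeneous d h" "x \<in> carrier R"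
  shows "\<pi> n (h \<otimes> x) = h \<otimes> \<pi> (n - d) x" "\<pi> n (x \<otimes> h) = \<pi> (n - d) x \<otimes> h"
  using assms component_mult_left[of h x n d] component_mult_right[of x h n d]
  by (simp_all add: homogeneous_def)

lemma homogeneous_mult:
  assumes "homogeneous c x" "homogeneous d y"
  shows "homogeneous (c + d) (x \<otimes> y)"
  using assms component_homogeneous_mult(1)[of c x y "c + d"] by (simp add: homogeneous_def)

lemma component_finsum:
  assumes "finite A" "f \<in> A \<rightarrow> carrier R"
  shows "\<pi> n (\<Oplus>i\<in>A. f i) = (\<Oplus>i\<in>A. \<pi> n (f i))"
  using assms by (induction A rule: finite_induct) (auto simp: Pi_def component_add)

lemma finsum_single:
  assumes "finite A" "k \<in> A" "z \<in> carrier R" "\<And>i. i \<in> A \<Longrightarrow> f i = (if i = k then z else \<zero>)"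
  shows "(\<Oplus>i\<in>A. f i) = z"
proof -
  have "(\<Oplus>i\<in>A. f i) = (\<Oplus>i\<in>A. if k = i then (\<lambda>_. z) i else \<zero>)"
    using assms by (intro add.finprod_cong') auto
  then show ?thesis using assms(1-3) add.finprod_singleton[of k A "\<lambda>_. z"] by simp
qed

lemma finsum_components:
  assumes x: "x \<in> carrier R" and A: "finite A" "support x \<subseteq> A"
  shows "(\<Oplus>i\<in>A. \<pi> i x) = x"
proof (rule component_ext)
  show "(\<Oplus>i\<in>A. \<pi> i x) \<in> carrier R" using x by (intro finsum_closed) auto
  fix n
  have eq: "\<pi> n (\<Oplus>i\<in>A. \<pi> i x) = (\<Oplus>i\<in>A. \<pi> n (\<pi> i x))"
    using A(1) x by (intro component_finsum) auto
  show "\<pi> n (\<Oplus>i\<in>A. \<pi> i x) = \<pi> n x"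
  proof (cases "n \<in> A")
    case True
    then show ?thesis unfolding eq using A(1) x by (intro finsum_single) (auto simp: component_component)
  next
    case False
    then have "(\<Oplus>i\<in>A. \<pi> n (\<pi> i x)) = (\<Oplus>i\<in>A. \<zero>)"
      using x by (intro add.finprod_cong') (auto simp: component_component)
    moreover have "\<pi> n x = \<zero>" using False A(2) by (auto simp: support_def)
    ultimately show ?thesis using eq by simp
  qed
qed (fact x)

text \<open>In general the degree \<open>n\<close> part of a product is a convolution sum. This
  special case, where at most one summand survives, serves to compare extreme degrees.\<close>

lemma component_mult_single:
  assumes x: "x \<in> carrier R" and y: "y \<in> carrier R"
    and other: "\<And>i. i \<noteq> k \<Longrightarrow> \<pi> i x \<otimes> \<pi> (n - i) y = \<zero>"
  shows "\<pi> n (x \<otimes> y) = \<pi> k x \<otimes> \<pi> (n - k) y"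
proof -
  let ?A = "insert k (support x)"
  have fin: "finite ?A" using finite_support[OF x] by (simp add: support_def)
  have "x \<otimes> y = (\<Oplus>i\<in>?A. \<pi> i x) \<otimes> y" using finsum_components[OF x fin subset_insertI] by simp
  also have "\<dots> = (\<Oplus>i\<in>?A. \<pi> i x \<otimes> y)" using fin x y by (intro finsum_ldistr) auto
  finally have "\<pi> n (x \<otimes> y) = (\<Oplus>i\<in>?A. \<pi> n (\<pi> i x \<otimes> y))"
    using component_finsum[OF fin, of "\<lambda>i. \<pi> i x \<otimes> y"] x y by (simp add: Pi_def)
  also have "\<dots> = \<pi> k x \<otimes> \<pi> (n - k) y"
    using fin x y other by (intro finsum_single) (auto simp: component_mult_left)
  finally show ?thesis .
qed

text \<open>Since \<open>y = x b^2\<close> lies in the radical, there is \<open>v\<close> with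
  \<open>v - v y = g\<close>. The lowest degree of \<open>v\<close> must then be 0, while the top
  component of \<open>v\<close> times \<open>b^2\<close> stands alone in a positive degree and has
  to vanish, which a right inverse of \<open>b^2\<close> relative to \<open>g\<close>
  excludes.\<close>

lemma corner_unit_zero:
  assumes x: "x \<in> jacobson_radical R" and supp: "\<And>j. j < - l \<or> 0 < j \<Longrightarrow> \<pi> j x = \<zero>" and l: "0 < l"
    and b: "homogeneous l b" and c: "c \<in> carrier R" and g: "homogeneous 0 g"
    and bc: "b \<otimes> c = g" and gb: "g \<otimes> b = b" and bg: "b \<otimes> g = b"
    and top: "\<pi> 0 x \<otimes> b = b" and bot: "\<pi> (- l) x \<otimes> b = g" and gx: "g \<otimes> (x \<otimes> b) = x \<otimes> b"
  shows "g = \<zero>"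
proof (rule ccontr)
  assume g0: "g \<noteq> \<zero>"
  have xc: "x \<in> carrier R" and bC: "b \<in> carrier R" and gc: "g \<in> carrier R"
    using x jacobson_radical_closed b g homogeneous_carrier by auto
  \<comment> \<open>One factor \<open>b\<close> would only raise the lowest possible degree of
    \<open>x\<close> from \<open>- l\<close> to 0. The second makes it \<open>l > 0\<close>, so that
    \<open>v \<otimes> y\<close> cannot reach the lowest degree of \<open>v\<close>.\<close>
  define y where "y = x \<otimes> (b \<otimes> b)"
  have bb: "homogeneous (l + l) (b \<otimes> b)" using homogeneous_mult[OF b b] .
  have yJ: "y \<in> jacobson_radical R" unfolding y_def using x bC by (intro jacobson_radical_mult_right) auto
  have yc: "y \<in> carrier R" using xc bC by (simp add: y_def)
  have \<pi>y: "\<pi> j y = \<pi> (j - (l + l)) x \<otimes> (b \<otimes> b)" for j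
    unfolding y_def using component_homogeneous_mult(2)[OF bb xc] .
  have ylow: "\<pi> j y = \<zero>" if "j < l" for j
    using that supp[of "j - (l + l)"] bC by (simp add: \<pi>y)
  have yhigh: "\<pi> j y = \<zero>" if "j > l + l" for j
    using that supp[of "j - (l + l)"] bC by (simp add: \<pi>y)
  have ytop: "\<pi> (l + l) y = b \<otimes> b"
    using top xc bC by (simp add: \<pi>y flip: m_assoc)
  have gy: "g \<otimes> y = y"
  proof -
    have "g \<otimes> y = g \<otimes> (x \<otimes> b) \<otimes> b" using gc xc bC by (simp add: y_def m_assoc)
    then show ?thesis using gx xc bC by (simp add: y_def m_assoc)
  qed
  have yg: "y \<otimes> g = y" using xc bC gc bg by (simp add: y_def m_assoc)
  have gg: "g \<otimes> g = g" using gb bc bC c gc by (metis m_assoc)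
  obtain u where u: "u \<in> carrier R" "u \<otimes> (\<one> \<ominus> y) = \<one>"
    using jacobson_radical_quasi_regular[OF yJ] .
  define v where "v = u \<otimes> g"
  have vc: "v \<in> carrier R" using u gc by (simp add: v_def)
  have vg: "v \<otimes> g = v" using u gc gg by (simp add: v_def m_assoc)
  \<comment> \<open>As \<open>g\<close> acts as an identity on both sides of \<open>y\<close>, the
    left inverse \<open>u\<close> of \<open>\<one> \<ominus> y\<close> yields a \<open>v\<close>
    with \<open>v (g - y) = g\<close>.\<close>
  have "v \<ominus> v \<otimes> y = (u \<otimes> (\<one> \<ominus> y)) \<otimes> g"
    using u(1) yc gc gy yg by (simp add: v_def m_assoc minus_eq l_distr r_distr l_minus r_minus)
  then have vy: "v \<ominus> v \<otimes> y = g" using u(2) gc by simp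
  have "v \<noteq> \<zero>" using vy g0 yc by (auto simp: minus_eq)
  define S where "S = support v"
  have S: "finite S" "S \<noteq> {}"
    using finite_support[OF vc] component_eq_zero[OF vc] \<open>v \<noteq> \<zero>\<close> by (auto simp: S_def support_def)
  have \<pi>v: "\<pi> n v \<ominus> \<pi> n (v \<otimes> y) = (if n = 0 then g else \<zero>)" for n
    using vy vc yc component_diff[of v "v \<otimes> y" n] component_homogeneous[OF g, of n] by simp
  have Smem: "\<pi> n v \<noteq> \<zero> \<Longrightarrow> Min S \<le> n \<and> n \<le> Max S" for n
    using S by (simp add: S_def support_def)
  have ne: "\<pi> (Min S) v \<noteq> \<zero>" "\<pi> (Max S) v \<noteq> \<zero>"
    using Min_in[OF S] Max_in[OF S] by (simp_all add: S_def support_def)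
  \<comment> \<open>Lowest degree: every component of \<open>v \<otimes> y\<close> sits at least
    \<open>l\<close> higher, so the lowest component of \<open>v\<close> survives in
    \<open>g\<close> and has degree 0.\<close>
  have "\<pi> (Min S) (v \<otimes> y) = \<pi> (Min S) v \<otimes> \<pi> (Min S - Min S) y"
  proof (rule component_mult_single[OF vc yc])
    fix i assume "i \<noteq> Min S"
    show "\<pi> i v \<otimes> \<pi> (Min S - i) y = \<zero>"
      using Smem[of i] ylow[of "Min S - i"] l vc yc by (cases "\<pi> i v = \<zero>") auto
  qed
  then have "\<pi> (Min S) (v \<otimes> y) = \<zero>" using ylow[of 0] l vc by simp
  then have "Min S = 0" using \<pi>v[of "Min S"] ne(1) vc by (auto simp: minus_eq split: if_splits)
  \<comment> \<open>Highest degree: nothing in \<open>v\<close> can cancel the product of the two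
    top components, and its degree is positive, so \<open>g\<close> has no component there.\<close>
  have "\<pi> (Max S + (l + l)) (v \<otimes> y) = \<pi> (Max S) v \<otimes> \<pi> (Max S + (l + l) - Max S) y"
  proof (rule component_mult_single[OF vc yc])
    fix i assume "i \<noteq> Max S"
    then show "\<pi> i v \<otimes> \<pi> (Max S + (l + l) - i) y = \<zero>"
      using Smem[of i] yhigh[of "Max S + (l + l) - i"] vc yc by (cases "\<pi> i v = \<zero>") auto
  qed
  then have "\<pi> (Max S + (l + l)) (v \<otimes> y) = \<pi> (Max S) v \<otimes> (b \<otimes> b)" using ytop by simp
  moreover have "\<pi> (Max S + (l + l)) v = \<zero>" using Smem[of "Max S + (l + l)"] l by force
  moreover have "Max S + (l + l) \<noteq> 0" using \<open>Min S = 0\<close> Min_le[OF S(1) Max_in[OF S]] l by simp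
  ultimately have "\<ominus> (\<pi> (Max S) v \<otimes> (b \<otimes> b)) = \<zero>"
    using \<pi>v[of "Max S + (l + l)"] vc bC by (simp add: minus_eq)
  then have z: "\<pi> (Max S) v \<otimes> (b \<otimes> b) = \<zero>"
    using vc bC by (metis component_closed m_closed minus_minus minus_zero)
  have "\<pi> (Max S) v = \<pi> (Max S) v \<otimes> g"
    using component_homogeneous_mult(2)[OF g vc, of "Max S"] vg by simp
  \<comment> \<open>Relative to \<open>g\<close>, the element \<open>c \<otimes> c\<close> is a
    right inverse of \<open>b \<otimes> b\<close>, so the vanishing product kills the top component
    of \<open>v\<close>.\<close>
  also have "g = b \<otimes> (b \<otimes> c) \<otimes> c" using bc bg by simp
  also have "\<dots> = (b \<otimes> b) \<otimes> (c \<otimes> c)" using bC c by (simp add: m_assoc)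
  also have "\<pi> (Max S) v \<otimes> \<dots> = (\<pi> (Max S) v \<otimes> (b \<otimes> b)) \<otimes> (c \<otimes> c)" using bC c vc by (simp add: m_assoc)
  also have "\<dots> = \<zero>" using z c by simp
  finally show False using ne(2) by simp
qed

theorem semiprimitive_if_graded_regular:
  assumes regular: "\<And>n x. homogeneous n x \<Longrightarrow> \<exists>y. homogeneous (- n) y \<and> x \<otimes> y \<otimes> x = x"
  shows "semiprimitive_ring R"
proof -
  let ?J = "jacobson_radical R"
  note J = left_idealD[OF left_ideal_jacobson_radical]
  have "\<not> (\<exists>a. a \<in> ?J \<and> a \<noteq> \<zero>)"
  proof
    assume "\<exists>a. a \<in> ?J \<and> a \<noteq> \<zero>"
    then obtain a where a: "a \<in> ?J" "a \<noteq> \<zero>"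
      and min: "\<And>z. z \<in> ?J \<Longrightarrow> z \<noteq> \<zero> \<Longrightarrow> card (support a) \<le> card (support z)"
      using ex_has_least_nat[of "\<lambda>a. a \<in> ?J \<and> a \<noteq> \<zero>" _ "\<lambda>a. card (support a)"] by blast
    have ac: "a \<in> carrier R" using a(1) by (rule jacobson_radical_closed)
    have sa: "finite (support a)" "support a \<noteq> {}"
      using finite_support[OF ac] component_eq_zero[OF ac] a(2) by (auto simp: support_def)
    define n where "n = Max (support a)"
    have an0: "\<pi> n a \<noteq> \<zero>" using Max_in[OF sa] by (simp add: n_def support_def)
    obtain d where d: "homogeneous (- n) d" "\<pi> n a \<otimes> d \<otimes> \<pi> n a = \<pi> n a"
      using regular[OF homogeneous_component[OF ac]] by blast
    have dc: "d \<in> carrier R" using d(1) by (rule homogeneous_carrier)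
    \<comment> \<open>This is an idempotent of degree 0 that fixes the top component of
      \<open>a\<close> from the left; hence it is nonzero.\<close>
    define f where "f = \<pi> n a \<otimes> d"
    have f: "homogeneous 0 f"
      using homogeneous_mult[OF homogeneous_component[OF ac] d(1), of n] by (simp add: f_def)
    have fc: "f \<in> carrier R" using f by (rule homogeneous_carrier)
    have ff: "f \<otimes> f = f" using d(2) ac dc by (simp add: f_def flip: m_assoc)
    have f0: "f \<noteq> \<zero>" using d(2) an0 ac by (auto simp: f_def)
    \<comment> \<open>The factor \<open>d\<close> moves the top degree \<open>n\<close> of
      \<open>a\<close> to 0, where the component becomes \<open>f\<close>; the outer factors put the
      result into the corner of \<open>f\<close>.\<close>
    define x where "x = f \<otimes> (a \<otimes> d) \<otimes> f"
    have xc: "x \<in> carrier R" using fc ac dc by (simp add: x_def)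
    have xJ: "x \<in> ?J"
      unfolding x_def using a(1) fc dc by (intro jacobson_radical_mult_right J(4)) auto
    have fx: "f \<otimes> x = x" using ff fc ac dc by (simp add: x_def flip: m_assoc)
    have xf: "x \<otimes> f = x" using ff fc ac dc by (simp add: x_def m_assoc)
    have \<pi>x: "\<pi> j x = f \<otimes> (\<pi> (j + n) a \<otimes> d) \<otimes> f" for j
      using f d(1) fc ac dc by (simp add: x_def component_homogeneous_mult)
    have x0: "\<pi> 0 x = f" using ff fc by (simp add: \<pi>x flip: f_def)
    have xpos: "\<pi> j x = \<zero>" if "0 < j" for j
    proof -
      have "j + n \<notin> support a" using that Max_ge[OF sa(1), of "j + n"] by (auto simp: n_def)
      then show ?thesis using fc dc by (simp add: \<pi>x support_def)
    qed
    \<comment> \<open>The number of components does not grow, so \<open>x\<close> inherits the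
      minimality of \<open>a\<close>.\<close>
    have "support x \<subseteq> (\<lambda>i. i - n) ` support a"
    proof
      fix j assume "j \<in> support x"
      then have "j + n \<in> support a" using fc dc by (auto simp: support_def \<pi>x)
      then show "j \<in> (\<lambda>i. i - n) ` support a" by (intro image_eqI[of _ _ "j + n"]) auto
    qed
    then have cx: "card (support x) \<le> card (support a)"
      using surj_card_le[OF sa(1)] by blast
    have sx: "finite (support x)" using finite_support[OF xc] by (simp add: support_def)
    have "0 \<in> support x" using x0 f0 by (simp add: support_def)
    \<comment> \<open>Commuting with \<open>r\<close> kills the component \<open>f\<close> of \<open>x\<close>, so minimality makes \<open>x\<close> central in \<open>f R f\<close>.\<close>
    have comm: "x \<otimes> r = r \<otimes> x" if r: "homogeneous k r" "f \<otimes> r = r" "r \<otimes> f = r" for k r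
    proof (rule ccontr)
      assume ne: "x \<otimes> r \<noteq> r \<otimes> x"
      have rc: "r \<in> carrier R" using r(1) by (rule homogeneous_carrier)
      define z where "z = x \<otimes> r \<ominus> r \<otimes> x"
      have "(\<ominus> \<one>) \<otimes> (r \<otimes> x) \<in> ?J" using xJ rc by (intro J(4)) auto
      then have "\<ominus> (r \<otimes> x) \<in> ?J" using rc xc by (simp add: l_minus)
      then have "z \<in> ?J"
        unfolding z_def minus_eq using xJ rc by (intro J(3) jacobson_radical_mult_right)
      moreover have "z \<noteq> \<zero>" using ne rc xc eq_if_diff_zero[of "x \<otimes> r" "r \<otimes> x"] by (auto simp: z_def)
      ultimately have "card (support x) \<le> card (support z)" using min cx by fastforce
      have \<pi>z: "\<pi> j z = \<pi> (j - k) x \<otimes> r \<ominus> r \<otimes> \<pi> (j - k) x" for j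
        using r(1) rc xc by (simp add: z_def component_diff component_homogeneous_mult)
      have "support z \<subseteq> (\<lambda>i. i + k) ` (support x - {0})"
      proof
        fix j assume j: "j \<in> support z"
        have "j - k \<in> support x - {0}"
        proof (rule ccontr)
          assume "j - k \<notin> support x - {0}"
          then consider "\<pi> (j - k) x = \<zero>" | "j - k = 0" by (auto simp: support_def)
          then have "\<pi> j z = \<zero>"
            using r rc by cases (simp_all add: \<pi>z x0 minus_eq r_neg)
          then show False using j by (simp add: support_def)
        qed
        then show "j \<in> (\<lambda>i. i + k) ` (support x - {0})" by (intro image_eqI[of _ _ "j - k"]) auto
      qed
      then have "card (support z) \<le> card (support x - {0})"
        using sx surj_card_le[of "support x - {0}"] by blast
      also have "\<dots> < card (support x)" using sx \<open>0 \<in> support x\<close> by (intro psubset_card_mono) auto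
      finally show False using \<open>card (support x) \<le> card (support z)\<close> by simp
    qed
    \<comment> \<open>The lowest degree of \<open>x\<close> is \<open>- l\<close>; it is at most 0
      because the component \<open>f\<close> sits in degree 0.\<close>
    define l where "l = - Min (support x)"
    have l0: "0 \<le> l" using Min_le[OF sx \<open>0 \<in> support x\<close>] by (simp add: l_def)
    have xneg: "\<pi> j x = \<zero>" if "j < - l" for j
      using that Min_le[OF sx, of j] by (auto simp: l_def support_def)
    define c where "c = \<pi> (- l) x"
    have c: "homogeneous (- l) c" unfolding c_def using xc by (rule homogeneous_component)
    have cc: "c \<in> carrier R" using c by (rule homogeneous_carrier)
    have c0: "c \<noteq> \<zero>"
      using Min_in[OF sx] \<open>0 \<in> support x\<close> by (auto simp: c_def l_def support_def)
    have cf: "f \<otimes> c = c" "c \<otimes> f = c"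
      using component_homogeneous_mult[OF f xc, of "- l"] fx xf by (simp_all add: c_def)
    show False
    proof (cases "l = 0")
      case True
      have "x = f"
      proof (rule component_ext[OF xc fc])
        show "\<pi> j x = \<pi> j f" for j
          using xneg[of j] xpos[of j] x0 component_homogeneous[OF f, of j] True
          by (cases j "0 :: int" rule: linorder_cases) auto
      qed
      then show False using jacobson_radical_idempotent xJ ff f0 by blast
    next
      case False
      then have "0 < l" using l0 by simp
      obtain b' where b': "homogeneous l b'" "c \<otimes> b' \<otimes> c = c"
        using regular[OF c] by auto
      have b'c: "b' \<in> carrier R" using b'(1) by (rule homogeneous_carrier)
      \<comment> \<open>Cutting \<open>b'\<close> down to the corner of \<open>f\<close> is what
        makes \<open>comm\<close> applicable later; \<open>c b' c = c\<close> is preserved as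
        \<open>c\<close> lies in that corner.\<close>
      define p where "p = f \<otimes> b' \<otimes> f"
      have pc: "p \<in> carrier R" using fc b'c by (simp add: p_def)
      have "homogeneous (0 + l + 0) p"
        unfolding p_def by (intro homogeneous_mult f b'(1))
      then have p: "homogeneous l p" by simp
      have fp: "f \<otimes> p = p" "p \<otimes> f = p" using ff fc b'c
        by (simp add: p_def flip: m_assoc, simp add: p_def m_assoc)
      have "c \<otimes> p \<otimes> c = (c \<otimes> f) \<otimes> b' \<otimes> (f \<otimes> c)" using fc b'c cc by (simp add: p_def m_assoc)
      then have cpc: "c \<otimes> p \<otimes> c = c" using cf b'(2) by simp
      \<comment> \<open>Passing to \<open>p c p\<close> makes the quasi-inverse reflexive: besides
        \<open>c b c = c\<close> it also satisfies \<open>b c b = b\<close>.\<close>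
      define b where "b = p \<otimes> c \<otimes> p"
      have "homogeneous (l + - l + l) b" unfolding b_def by (intro homogeneous_mult p c)
      then have b: "homogeneous l b" by simp
      have bC: "b \<in> carrier R" using b by (rule homogeneous_carrier)
      have fb: "f \<otimes> b = b" "b \<otimes> f = b" using fp fc pc cc
        by (simp add: b_def flip: m_assoc, simp add: b_def m_assoc)
      have cbc: "c \<otimes> b \<otimes> c = c"
      proof -
        have "c \<otimes> b \<otimes> c = c \<otimes> p \<otimes> c \<otimes> p \<otimes> c" using cc pc by (simp add: b_def m_assoc)
        then show ?thesis using cpc by simp
      qed
      have bcb: "b \<otimes> c \<otimes> b = b"
      proof -
        have "b \<otimes> c \<otimes> b = p \<otimes> (c \<otimes> p \<otimes> c \<otimes> p \<otimes> c) \<otimes> p" using cc pc by (simp add: b_def m_assoc)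
        then show ?thesis using cpc by (simp add: b_def)
      qed
      have xb: "x \<otimes> b = b \<otimes> x" by (rule comm[OF b fb])
      \<comment> \<open>Since \<open>b\<close> has degree \<open>l\<close>, the degree 0 part of
        \<open>x b = b x\<close> involves only the lowest component \<open>c\<close> of
        \<open>x\<close>.\<close>
      have "\<pi> 0 (x \<otimes> b) = \<pi> 0 (b \<otimes> x)" using xb by simp
      then have cb: "c \<otimes> b = b \<otimes> c" using b xc by (simp add: component_homogeneous_mult c_def)
      define g where "g = b \<otimes> c"
      have gc: "g \<in> carrier R" using bC cc by (simp add: g_def)
      have "homogeneous (l + - l) g" unfolding g_def by (rule homogeneous_mult[OF b c])
      then have g: "homogeneous 0 g" by simp
      have gb: "g \<otimes> b = b" using bcb by (simp add: g_def)
      have "b \<otimes> g = b \<otimes> c \<otimes> b" by (simp only: g_def m_assoc[OF bC cc bC] cb)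
      then have bg: "b \<otimes> g = b" by (simp only: bcb)
      have gx: "g \<otimes> (x \<otimes> b) = x \<otimes> b"
        using gb gc bC xc by (simp add: xb flip: m_assoc)
      have "g = \<zero>"
      proof (rule corner_unit_zero[OF xJ _ \<open>0 < l\<close> b cc g _ gb bg _ _ gx])
        show "\<pi> j x = \<zero>" if "j < - l \<or> 0 < j" for j using that xneg xpos by auto
        show "\<pi> 0 x \<otimes> b = b" using x0 fb by simp
        show "\<pi> (- l) x \<otimes> b = g" using cb by (simp add: g_def flip: c_def)
      qed (simp add: g_def)
      \<comment> \<open>Thus \<open>g\<close> fixes the lowest component \<open>c\<close>, and
        \<open>g = \<zero>\<close> would make it vanish.\<close>
      moreover have "g \<otimes> c = c" using cbc by (simp only: g_def cb)
      ultimately show False using cc c0 by simp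
    qed
  qed
  then have "?J = {\<zero>}" using J(2) by blast
  then show ?thesis by (simp only: semiprimitive_ring_def)
qed

end

section \<open>Rings with homogeneous relations\<close>

definition word_degree :: "('x \<Rightarrow> int) \<Rightarrow> 'x fmonoid \<Rightarrow> int" where
  "word_degree \<delta> w = sum_list (map \<delta> (letters w))"

lemma word_degree_add [simp]: "word_degree \<delta> (u + v) = word_degree \<delta> u + word_degree \<delta> v"
  by (simp add: word_degree_def plus_fmonoid_def)

lemma word_degree_zero [simp]: "word_degree \<delta> 0 = 0"
  by (simp add: word_degree_def zero_fmonoid_def)

text \<open>The zero polynomial counts as homogeneous of every degree.\<close>

definition homogeneous_poly :: "('x \<Rightarrow> int) \<Rightarrow> int \<Rightarrow> ('x fmonoid \<Rightarrow>\<^sub>0 int) \<Rightarrow> bool" where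
  "homogeneous_poly \<delta> d p \<longleftrightarrow> (\<forall>w \<in> Poly_Mapping.keys p. word_degree \<delta> w = d)"

lemma homogeneous_poly_one: "homogeneous_poly \<delta> 0 1"
  by (simp add: homogeneous_poly_def)

lemma homogeneous_poly_free_gen: "homogeneous_poly \<delta> (\<delta> x) (free_gen x)"
  by (simp add: homogeneous_poly_def free_gen_def word_degree_def)

lemma homogeneous_poly_add:
  "homogeneous_poly \<delta> d p \<Longrightarrow> homogeneous_poly \<delta> d q \<Longrightarrow> homogeneous_poly \<delta> d (p + q)"
  using Poly_Mapping.keys_add[of p q] by (auto simp: homogeneous_poly_def)

lemma homogeneous_poly_diff:
  "homogeneous_poly \<delta> d p \<Longrightarrow> homogeneous_poly \<delta> d q \<Longrightarrow> homogeneous_poly \<delta> d (p - q)"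
  using keys_diff[of p q] by (auto simp: homogeneous_poly_def)

lemma homogeneous_poly_mult:
  "homogeneous_poly \<delta> c p \<Longrightarrow> homogeneous_poly \<delta> d q \<Longrightarrow> homogeneous_poly \<delta> (c + d) (p * q)"
  using keys_mult[of p q] by (fastforce simp: homogeneous_poly_def)

lift_definition poly_component :: "('x \<Rightarrow> int) \<Rightarrow> int \<Rightarrow> ('x fmonoid \<Rightarrow>\<^sub>0 int) \<Rightarrow> ('x fmonoid \<Rightarrow>\<^sub>0 int)"
  is "\<lambda>\<delta> n p w. if word_degree \<delta> w = n then p w else 0"
  by (erule finite_subset[rotated]) auto

lemma keys_poly_component:
  "Poly_Mapping.keys (poly_component \<delta> n p) = {w \<in> Poly_Mapping.keys p. word_degree \<delta> w = n}"
  by transfer auto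

lemma poly_component_add: "poly_component \<delta> n (p + q) = poly_component \<delta> n p + poly_component \<delta> n q"
  by transfer auto

lemma poly_component_diff: "poly_component \<delta> n (p - q) = poly_component \<delta> n p - poly_component \<delta> n q"
  by transfer auto

lemma poly_component_zero [simp]: "poly_component \<delta> n 0 = 0"
  by transfer auto

lemma poly_component_homogeneous:
  "homogeneous_poly \<delta> d p \<Longrightarrow> poly_component \<delta> n p = (if n = d then p else 0)"
  unfolding homogeneous_poly_def by transfer fastforce

lemma homogeneous_poly_component: "homogeneous_poly \<delta> n (poly_component \<delta> n p)"
  by (simp add: homogeneous_poly_def keys_poly_component)

lemma poly_component_eq_zero:
  "(\<And>w. w \<in> Poly_Mapping.keys p \<Longrightarrow> word_degree \<delta> w \<noteq> n) \<Longrightarrow> poly_component \<delta> n p = 0"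
  by transfer fastforce

text \<open>Split \<open>q\<close> into its component of degree \<open>n - d\<close> and the rest.
  Degrees of words add, so the rest contributes no word of degree \<open>n\<close>.\<close>

lemma poly_component_mult_left:
  assumes "homogeneous_poly \<delta> d p"
  shows "poly_component \<delta> n (p * q) = p * poly_component \<delta> (n - d) q"
proof -
  let ?q = "poly_component \<delta> (n - d) q"
  have "homogeneous_poly \<delta> n (p * ?q)"
    using homogeneous_poly_mult[OF assms homogeneous_poly_component, of "n - d" q] by simp
  then have "poly_component \<delta> n (p * ?q) = p * ?q" by (simp add: poly_component_homogeneous)
  moreover have "poly_component \<delta> n (p * (q - ?q)) = 0"
  proof (rule poly_component_eq_zero)
    fix w assume "w \<in> Poly_Mapping.keys (p * (q - ?q))"
    then obtain u v where w: "w = u + v" "u \<in> Poly_Mapping.keys p" "v \<in> Poly_Mapping.keys (q - ?q)"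
      using keys_mult[of p "q - ?q"] by blast
    have "word_degree \<delta> v \<noteq> n - d" using w(3) by transfer auto
    then show "word_degree \<delta> w \<noteq> n" using w assms by (auto simp: homogeneous_poly_def)
  qed
  ultimately have "poly_component \<delta> n (p * ?q + p * (q - ?q)) = p * ?q"
    by (simp only: poly_component_add add_0_right)
  then show ?thesis by (simp flip: distrib_left)
qed

lemma poly_component_mult_right:
  assumes "homogeneous_poly \<delta> d q"
  shows "poly_component \<delta> n (p * q) = poly_component \<delta> (n - d) p * q"
proof -
  let ?p = "poly_component \<delta> (n - d) p"
  have "homogeneous_poly \<delta> n (?p * q)"
    using homogeneous_poly_mult[OF homogeneous_poly_component assms, of "n - d" p] by simp
  then have "poly_component \<delta> n (?p * q) = ?p * q" by (simp add: poly_component_homogeneous)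
  moreover have "poly_component \<delta> n ((p - ?p) * q) = 0"
  proof (rule poly_component_eq_zero)
    fix w assume "w \<in> Poly_Mapping.keys ((p - ?p) * q)"
    then obtain u v where w: "w = u + v" "u \<in> Poly_Mapping.keys (p - ?p)" "v \<in> Poly_Mapping.keys q"
      using keys_mult[of "p - ?p" q] by blast
    have "word_degree \<delta> u \<noteq> n - d" using w(2) by transfer auto
    then show "word_degree \<delta> w \<noteq> n" using w assms by (auto simp: homogeneous_poly_def)
  qed
  ultimately have "poly_component \<delta> n (?p * q + (p - ?p) * q) = ?p * q"
    by (simp only: poly_component_add add_0_right)
  then show ?thesis by (simp flip: distrib_right)
qed

lemma sum_poly_component:
  assumes "finite D" "word_degree \<delta> ` Poly_Mapping.keys p \<subseteq> D"
  shows "(\<Sum>i\<in>D. poly_component \<delta> i p) = p"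
proof (rule poly_mapping_eqI)
  fix w
  have "Poly_Mapping.lookup (\<Sum>i\<in>D. poly_component \<delta> i p) w
      = (\<Sum>i\<in>D. if word_degree \<delta> w = i then Poly_Mapping.lookup p w else 0)"
    by (simp add: lookup_sum poly_component.rep_eq)
  also have "\<dots> = (if word_degree \<delta> w \<in> D then Poly_Mapping.lookup p w else 0)"
    using assms(1) by simp
  also have "\<dots> = Poly_Mapping.lookup p w"
    using assms(2) by (auto simp: in_keys_iff image_subset_iff)
  finally show "Poly_Mapping.lookup (\<Sum>i\<in>D. poly_component \<delta> i p) w = Poly_Mapping.lookup p w" .
qed

lemma free_ring_sel [simp]:
  "x \<otimes>\<^bsub>free_ring X\<^esub> y = x * y" "x \<oplus>\<^bsub>free_ring X\<^esub> y = x + y"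
  "\<zero>\<^bsub>free_ring X\<^esub> = 0" "\<one>\<^bsub>free_ring X\<^esub> = 1"
  by (simp_all add: free_ring_def)

lemma free_ring_minus:
  assumes "q \<in> carrier (free_ring X)"
  shows "\<ominus>\<^bsub>free_ring X\<^esub> q = - q"
proof -
  interpret F: ring "free_ring X" by (rule ring_free_ring)
  have "- q \<in> carrier (free_ring X)" using assms by (simp add: free_ring_def)
  then show ?thesis using assms by - (rule F.minus_equality, simp_all)
qed

lemma poly_component_closed:
  "p \<in> carrier (free_ring X) \<Longrightarrow> poly_component \<delta> n p \<in> carrier (free_ring X)"
  by (simp add: free_ring_def keys_poly_component)

section \<open>Quotients of free rings by homogeneous relators\<close>

locale graded_presentation =
  fixes X :: "'x set" and \<delta> :: "'x \<Rightarrow> int" and A :: "('x fmonoid \<Rightarrow>\<^sub>0 int) set"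
  assumes relators_closed: "A \<subseteq> carrier (free_ring X)"
    and relators_homogeneous: "a \<in> A \<Longrightarrow> \<exists>d. homogeneous_poly \<delta> d a"
begin

abbreviation F where "F \<equiv> free_ring X"
abbreviation I where "I \<equiv> genideal F A"
abbreviation Q where "Q \<equiv> F Quot I"
abbreviation cls :: "('x fmonoid \<Rightarrow>\<^sub>0 int) \<Rightarrow> ('x fmonoid \<Rightarrow>\<^sub>0 int) set" where
  "cls p \<equiv> I +>\<^bsub>F\<^esub> p"

sublocale F: ring F by (rule ring_free_ring)

sublocale I: ideal I F by (rule F.genideal_ideal[OF relators_closed])

sublocale Q: ring Q by (rule I.quotient_is_ring)

lemma ideal_sum: "(\<And>i. i \<in> D \<Longrightarrow> f i \<in> I) \<Longrightarrow> sum f D \<in> I"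
proof (induction D rule: infinite_finite_induct)
  case (insert i D)
  then show ?case using I.a_closed[of "f i" "sum f D"] by simp
qed (use I.zero_closed in simp_all)

lemma free_diff_closed: "p \<in> carrier F \<Longrightarrow> q \<in> carrier F \<Longrightarrow> p - q \<in> carrier F"
  using F.minus_closed[of p q] by (simp add: a_minus_def free_ring_minus)

text \<open>The polynomials all of whose components lie in \<open>I\<close> form an ideal: for
  closure under products the other factor is split into homogeneous parts, which only shift degrees.
  This ideal contains the homogeneous relators, hence all of \<open>I\<close>. The grading therefore
  descends to the quotient.\<close>

lemma ideal_poly_component:
  assumes "p \<in> I"
  shows "poly_component \<delta> n p \<in> I"
proof -
  let ?K = "{p \<in> carrier F. \<forall>n. poly_component \<delta> n p \<in> I}"
  have mult: "x * p \<in> ?K" "p * x \<in> ?K" if p: "p \<in> ?K" and x: "x \<in> carrier F" for p x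
  proof -
    let ?D = "word_degree \<delta> ` Poly_Mapping.keys x"
    have "poly_component \<delta> n (x * p) \<in> I" for n
    proof -
      have "poly_component \<delta> n (x * p) = poly_component \<delta> n (\<Sum>i\<in>?D. poly_component \<delta> i x * p)"
        by (simp add: sum_poly_component flip: sum_distrib_right)
      also have "\<dots> = (\<Sum>i\<in>?D. poly_component \<delta> n (poly_component \<delta> i x * p))"
        by (rule sum_comp_morphism[symmetric, unfolded comp_def]) (simp_all add: poly_component_add)
      also have "\<dots> = (\<Sum>i\<in>?D. poly_component \<delta> i x * poly_component \<delta> (n - i) p)"
        by (simp add: poly_component_mult_left[OF homogeneous_poly_component])
      also have "\<dots> \<in> I"
        using p I.I_l_closed[OF _ poly_component_closed[OF x]] by (intro ideal_sum) simp
      finally show ?thesis .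
    qed
    moreover have "poly_component \<delta> n (p * x) \<in> I" for n
    proof -
      have "poly_component \<delta> n (p * x) = poly_component \<delta> n (\<Sum>i\<in>?D. p * poly_component \<delta> i x)"
        by (simp add: sum_poly_component flip: sum_distrib_left)
      also have "\<dots> = (\<Sum>i\<in>?D. poly_component \<delta> n (p * poly_component \<delta> i x))"
        by (rule sum_comp_morphism[symmetric, unfolded comp_def]) (simp_all add: poly_component_add)
      also have "\<dots> = (\<Sum>i\<in>?D. poly_component \<delta> (n - i) p * poly_component \<delta> i x)"
        by (simp add: poly_component_mult_right[OF homogeneous_poly_component])
      also have "\<dots> \<in> I"
        using p I.I_r_closed[OF _ poly_component_closed[OF x]] by (intro ideal_sum) simp
      finally show ?thesis .
    qed
    ultimately show "x * p \<in> ?K" "p * x \<in> ?K"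
      using p x F.m_closed[of x p] F.m_closed[of p x] by simp_all
  qed
  have "ideal ?K F"
  proof (rule idealI[OF F.ring_axioms])
    show "subgroup ?K (add_monoid F)"
    proof (rule F.add.subgroupI)
      show "?K \<noteq> {}" using I.zero_closed F.zero_closed by (intro ex_in_conv[THEN iffD1] exI[of _ 0]) simp
    next
      fix p assume p: "p \<in> ?K"
      have "- 1 \<in> carrier F" using free_ring_minus[of 1 X] F.one_closed F.a_inv_closed[of 1] by simp
      then show "\<ominus>\<^bsub>F\<^esub> p \<in> ?K" using mult(1)[OF p, of "- 1"] p by (simp add: free_ring_minus)
    next
      fix p q assume "p \<in> ?K" "q \<in> ?K"
      then show "p \<oplus>\<^bsub>F\<^esub> q \<in> ?K"
        using F.a_closed[of p q] I.a_closed by (simp add: poly_component_add)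
    qed blast
  qed (use mult in auto)
  moreover have "A \<subseteq> ?K"
  proof
    fix a assume a: "a \<in> A"
    then obtain d where d: "homogeneous_poly \<delta> d a" using relators_homogeneous by blast
    have "a \<in> I" using F.genideal_self[OF relators_closed] a by blast
    then show "a \<in> ?K"
      using a relators_closed d I.zero_closed by (auto simp: poly_component_homogeneous)
  qed
  ultimately have "I \<subseteq> ?K" by (rule F.genideal_minimal)
  then show ?thesis using assms by blast
qed

lemma cls_eq_iff:
  assumes "p \<in> carrier F" "q \<in> carrier F"
  shows "cls p = cls q \<longleftrightarrow> p - q \<in> I"
  using F.quotient_eq_iff_same_a_r_cos[OF I.ideal_axioms assms] assms
  by (simp add: a_minus_def free_ring_minus)

lemma cls_closed: "p \<in> carrier F \<Longrightarrow> cls p \<in> carrier Q"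
  using I.rcos_ring_hom by (rule ring_hom_closed)

lemma cls_add: "p \<in> carrier F \<Longrightarrow> q \<in> carrier F \<Longrightarrow> cls (p + q) = cls p \<oplus>\<^bsub>Q\<^esub> cls q"
  using ring_hom_add[OF I.rcos_ring_hom] by simp

lemma cls_mult: "p \<in> carrier F \<Longrightarrow> q \<in> carrier F \<Longrightarrow> cls (p * q) = cls p \<otimes>\<^bsub>Q\<^esub> cls q"
  using ring_hom_mult[OF I.rcos_ring_hom] by simp

lemma cls_one: "cls 1 = \<one>\<^bsub>Q\<^esub>"
  using ring_hom_one[OF I.rcos_ring_hom] by simp

lemma cls_zero: "cls 0 = \<zero>\<^bsub>Q\<^esub>"
  using ring_hom_zero[OF I.rcos_ring_hom F.ring_axioms Q.ring_axioms] by simp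

lemma cls_eq_zero_iff: "p \<in> carrier F \<Longrightarrow> cls p = \<zero>\<^bsub>Q\<^esub> \<longleftrightarrow> p \<in> I"
  using cls_eq_iff[of p 0] F.zero_closed by (simp add: cls_zero)

lemma cls_diff: "p \<in> carrier F \<Longrightarrow> q \<in> carrier F \<Longrightarrow> cls (p - q) = cls p \<ominus>\<^bsub>Q\<^esub> cls q"
  using cls_add[of "p - q" q] free_diff_closed[of p q] cls_closed[of "p - q"] cls_closed[of q]
  by (simp add: a_minus_def Q.a_assoc Q.r_neg)

lemma cls_relator:
  assumes "p - q \<in> A" "p \<in> carrier F" "q \<in> carrier F"
  shows "cls p = cls q"
  using F.genideal_self[OF relators_closed] assms by (auto simp: cls_eq_iff)

lemma cls_cases:
  assumes "Z \<in> carrier Q"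
  obtains p where "p \<in> carrier F" "Z = cls p"
  using assms by (auto simp: FactRing_def A_RCOSETS_def')

text \<open>The representative is picked by choice; \<open>component_cls\<close> shows that the
  result does not depend on it, because \<open>I\<close> contains the components of its
  elements.\<close>

definition component :: "int \<Rightarrow> ('x fmonoid \<Rightarrow>\<^sub>0 int) set \<Rightarrow> ('x fmonoid \<Rightarrow>\<^sub>0 int) set" where
  "component n Z = cls (poly_component \<delta> n (SOME p. p \<in> carrier F \<and> Z = cls p))"

lemma component_cls:
  assumes "p \<in> carrier F"
  shows "component n (cls p) = cls (poly_component \<delta> n p)"
proof -
  define q where "q = (SOME q. q \<in> carrier F \<and> cls p = cls q)"
  have q: "q \<in> carrier F" "cls p = cls q"
    using someI[of "\<lambda>q. q \<in> carrier F \<and> cls p = cls q" p] assms by (auto simp: q_def)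
  then have "q - p \<in> I" using cls_eq_iff[OF q(1) assms] by blast
  then have "poly_component \<delta> n q - poly_component \<delta> n p \<in> I"
    using ideal_poly_component by (simp flip: poly_component_diff)
  then have "cls (poly_component \<delta> n q) = cls (poly_component \<delta> n p)"
    using q(1) assms by (simp add: cls_eq_iff poly_component_closed)
  then show ?thesis unfolding component_def q_def .
qed

lemma component_component_poly:
  "poly_component \<delta> m (poly_component \<delta> n p) = (if m = n then poly_component \<delta> n p else 0)"
  by (rule poly_component_homogeneous[OF homogeneous_poly_component])

sublocale graded_ring Q component
proof unfold_locales
  fix Z n assume "Z \<in> carrier Q"
  then show "component n Z \<in> carrier Q"
    by (elim cls_cases) (simp add: component_cls cls_closed poly_component_closed)
next
  fix Z W n assume "Z \<in> carrier Q" "W \<in> carrier Q"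
  then obtain p q where "p \<in> carrier F" "Z = cls p" "q \<in> carrier F" "W = cls q"
    by (elim cls_cases)
  then show "component n (Z \<oplus>\<^bsub>Q\<^esub> W) = component n Z \<oplus>\<^bsub>Q\<^esub> component n W"
    using F.a_closed[of p q]
    by (simp add: component_cls poly_component_closed poly_component_add flip: cls_add)
next
  fix Z m n assume "Z \<in> carrier Q"
  then show "component m (component n Z) = (if m = n then component n Z else \<zero>\<^bsub>Q\<^esub>)"
    by (elim cls_cases)
      (simp add: component_cls poly_component_closed component_component_poly cls_zero)
next
  fix Z assume "Z \<in> carrier Q"
  then obtain p where p: "p \<in> carrier F" "Z = cls p" by (elim cls_cases)
  have "n \<in> word_degree \<delta> ` Poly_Mapping.keys p" if "component n Z \<noteq> \<zero>\<^bsub>Q\<^esub>" for n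
  proof (rule ccontr)
    assume "n \<notin> word_degree \<delta> ` Poly_Mapping.keys p"
    then have "poly_component \<delta> n p = 0" by - (rule poly_component_eq_zero, blast)
    then have "component n Z = \<zero>\<^bsub>Q\<^esub>" unfolding p(2) component_cls[OF p(1)] by (simp only: cls_zero)
    then show False using that by simp
  qed
  then have "{n. component n Z \<noteq> \<zero>\<^bsub>Q\<^esub>} \<subseteq> word_degree \<delta> ` Poly_Mapping.keys p" by blast
  then show "finite {n. component n Z \<noteq> \<zero>\<^bsub>Q\<^esub>}" by (rule finite_subset) simp
next
  fix Z assume Z: "Z \<in> carrier Q" "\<And>n. component n Z = \<zero>\<^bsub>Q\<^esub>"
  obtain p where p: "p \<in> carrier F" "Z = cls p" using Z(1) by (elim cls_cases)
  \<comment> \<open>A polynomial is the sum of its components; if these all lie in \<open>I\<close>,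
    so does the polynomial.\<close>
  have "(\<Sum>i\<in>word_degree \<delta> ` Poly_Mapping.keys p. poly_component \<delta> i p) \<in> I"
    using Z(2) p by (intro ideal_sum) (simp add: component_cls cls_eq_zero_iff poly_component_closed)
  then show "Z = \<zero>\<^bsub>Q\<^esub>" using p by (simp add: sum_poly_component cls_eq_zero_iff)
next
  fix Z W n d assume "Z \<in> carrier Q" "W \<in> carrier Q"
  then obtain p q where "p \<in> carrier F" "Z = cls p" "q \<in> carrier F" "W = cls q"
    by (elim cls_cases)
  then show "component n (component d Z \<otimes>\<^bsub>Q\<^esub> W) = component d Z \<otimes>\<^bsub>Q\<^esub> component (n - d) W"
    and "component n (Z \<otimes>\<^bsub>Q\<^esub> component d W) = component (n - d) Z \<otimes>\<^bsub>Q\<^esub> component d W"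
    using F.m_closed[of "poly_component \<delta> d p" q] F.m_closed[of p "poly_component \<delta> d q"]
    by (simp_all add: component_cls poly_component_closed
        poly_component_mult_left[OF homogeneous_poly_component]
        poly_component_mult_right[OF homogeneous_poly_component] flip: cls_mult)
qed

lemma homogeneous_cls:
  "p \<in> carrier F \<Longrightarrow> homogeneous_poly \<delta> d p \<Longrightarrow> homogeneous d (cls p)"
  by (simp add: homogeneous_def component_cls cls_closed poly_component_homogeneous)

text \<open>A homogeneous class is represented by the degree \<open>n\<close> component of any
  representative, which is an integer combination of words of degree \<open>n\<close>. Closure under
  differences is enough to build these from words, and is the form that
  \<open>frag_induction\<close> offers.\<close>

lemma homogeneous_induct:
  assumes Z: "homogeneous n Z"
    and zero: "P \<zero>\<^bsub>Q\<^esub>"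
    and word: "\<And>w. set (letters w) \<subseteq> X \<Longrightarrow> word_degree \<delta> w = n \<Longrightarrow> P (cls (Poly_Mapping.single w 1))"
    and diff: "\<And>Y Z. P Y \<Longrightarrow> P Z \<Longrightarrow> P (Y \<ominus>\<^bsub>Q\<^esub> Z)"
  shows "P Z"
proof -
  obtain p where p: "p \<in> carrier F" "Z = cls p" using homogeneous_carrier[OF Z] by (elim cls_cases)
  then have eq: "Z = cls (poly_component \<delta> n p)" using Z by (simp add: homogeneous_def component_cls)
  have "Poly_Mapping.keys (poly_component \<delta> n p) \<subseteq> {w. set (letters w) \<subseteq> X \<and> word_degree \<delta> w = n}"
    using p(1) by (auto simp: keys_poly_component free_ring_def)
  \<comment> \<open>Membership in the carrier is carried through the induction because
    \<open>cls_diff\<close> requires it.\<close>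
  then have "poly_component \<delta> n p \<in> carrier F \<and> P (cls (poly_component \<delta> n p))"
  proof (induction rule: frag_induction)
    case zero
    then show ?case using assms(2) F.zero_closed by (simp add: cls_zero)
  next
    case (one w)
    then show ?case using word by (simp add: free_ring_def)
  next
    case (diff p q)
    then show ?case using assms(4) by (simp add: free_diff_closed cls_diff)
  qed
  then show ?thesis using eq by simp
qed

end

section \<open>Corner skew Laurent polynomials\<close>

text \<open>The consequences of the relations are derived in an arbitrary ring \<open>S\<close>
  containing a solution of them; the presented ring is one instance. Surjectivity of \<phi> onto the
  corner enters as \<open>\<phi>_corner\<close>.\<close>

locale corner_skew_relations = R: ring R + S: ring S
  for R :: "('a, 'm) ring_scheme" and S :: "('b, 'n) ring_scheme" +
  fixes e :: 'a and \<phi> :: "'a \<Rightarrow> 'a" and \<rho> :: "'a \<Rightarrow> 'b" and tp tm :: 'b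
  assumes e: "e \<in> carrier R"
    and \<phi>_closed: "r \<in> carrier R \<Longrightarrow> \<phi> r \<in> carrier R"
    and \<phi>_corner: "r \<in> carrier R \<Longrightarrow> \<exists>s \<in> carrier R. \<phi> s = e \<otimes>\<^bsub>R\<^esub> r \<otimes>\<^bsub>R\<^esub> e"
    and \<rho>: "\<rho> \<in> ring_hom R S"
    and t_closed [simp]: "tp \<in> carrier S" "tm \<in> carrier S"
    and tm_tp: "tm \<otimes>\<^bsub>S\<^esub> tp = \<one>\<^bsub>S\<^esub>"
    and tp_tm: "tp \<otimes>\<^bsub>S\<^esub> tm = \<rho> e"
    and tp_\<rho>: "r \<in> carrier R \<Longrightarrow> tp \<otimes>\<^bsub>S\<^esub> \<rho> r = \<rho> (\<phi> r) \<otimes>\<^bsub>S\<^esub> tp"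
    and \<rho>_tm: "r \<in> carrier R \<Longrightarrow> \<rho> r \<otimes>\<^bsub>S\<^esub> tm = tm \<otimes>\<^bsub>S\<^esub> \<rho> (\<phi> r)"
begin

text \<open>Coefficients stand to the left of \<open>tp\<close> and to the right of
  \<open>tm\<close>, the directions in which the relations move them by applying \<phi>. In the
  presented ring this set turns out to be the homogeneous component of degree
  \<open>n\<close>.\<close>

definition spanned :: "int \<Rightarrow> 'b set" where
  "spanned n =
     (if 0 \<le> n then {\<rho> r \<otimes>\<^bsub>S\<^esub> tp [^]\<^bsub>S\<^esub> nat n | r. r \<in> carrier R}
      else {tm [^]\<^bsub>S\<^esub> nat (- n) \<otimes>\<^bsub>S\<^esub> \<rho> r | r. r \<in> carrier R})"

lemma \<rho>_closed [simp]: "r \<in> carrier R \<Longrightarrow> \<rho> r \<in> carrier S"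
  using \<rho> by (rule ring_hom_closed)

lemma \<rho>_mult: "r \<in> carrier R \<Longrightarrow> s \<in> carrier R \<Longrightarrow> \<rho> (r \<otimes>\<^bsub>R\<^esub> s) = \<rho> r \<otimes>\<^bsub>S\<^esub> \<rho> s"
  using \<rho> by (rule ring_hom_mult)

lemma \<rho>_one: "\<rho> \<one>\<^bsub>R\<^esub> = \<one>\<^bsub>S\<^esub>"
  using \<rho> by (rule ring_hom_one)

lemma \<rho>_diff: "r \<in> carrier R \<Longrightarrow> s \<in> carrier R \<Longrightarrow> \<rho> (r \<ominus>\<^bsub>R\<^esub> s) = \<rho> r \<ominus>\<^bsub>S\<^esub> \<rho> s"
  using ring_hom_add[OF \<rho>, of "r \<ominus>\<^bsub>R\<^esub> s" s]
  by (simp add: a_minus_def R.a_assoc R.l_neg S.a_assoc S.r_neg)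

lemma tp_pow_Suc: "tp [^]\<^bsub>S\<^esub> Suc k = tp \<otimes>\<^bsub>S\<^esub> tp [^]\<^bsub>S\<^esub> k"
  by (rule S.nat_pow_Suc2) simp

lemma tm_pow_Suc: "tm [^]\<^bsub>S\<^esub> Suc k = tm \<otimes>\<^bsub>S\<^esub> tm [^]\<^bsub>S\<^esub> k"
  by (rule S.nat_pow_Suc2) simp

lemma \<phi>_pow_closed: "r \<in> carrier R \<Longrightarrow> (\<phi> ^^ k) r \<in> carrier R"
  by (induction k) (simp_all add: \<phi>_closed)

lemma \<rho>_tm_pow: "r \<in> carrier R \<Longrightarrow> \<rho> r \<otimes>\<^bsub>S\<^esub> tm [^]\<^bsub>S\<^esub> k = tm [^]\<^bsub>S\<^esub> k \<otimes>\<^bsub>S\<^esub> \<rho> ((\<phi> ^^ k) r)"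
proof (induction k)
  case (Suc k)
  have "\<rho> r \<otimes>\<^bsub>S\<^esub> tm [^]\<^bsub>S\<^esub> Suc k = (\<rho> r \<otimes>\<^bsub>S\<^esub> tm [^]\<^bsub>S\<^esub> k) \<otimes>\<^bsub>S\<^esub> tm"
    using Suc.prems by (simp add: S.m_assoc)
  also have "\<dots> = tm [^]\<^bsub>S\<^esub> k \<otimes>\<^bsub>S\<^esub> (\<rho> ((\<phi> ^^ k) r) \<otimes>\<^bsub>S\<^esub> tm)"
    using Suc by (simp add: S.m_assoc \<phi>_pow_closed)
  also have "\<dots> = tm [^]\<^bsub>S\<^esub> k \<otimes>\<^bsub>S\<^esub> (tm \<otimes>\<^bsub>S\<^esub> \<rho> ((\<phi> ^^ Suc k) r))"
    using Suc.prems by (simp add: \<rho>_tm \<phi>_pow_closed)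
  also have "\<dots> = tm [^]\<^bsub>S\<^esub> Suc k \<otimes>\<^bsub>S\<^esub> \<rho> ((\<phi> ^^ Suc k) r)"
    using Suc.prems \<phi>_pow_closed[of r "Suc k"] by (simp add: S.m_assoc)
  finally show ?case .
qed simp

text \<open>This is where surjectivity of \<phi> onto \<open>e R e\<close> is used. As
  \<open>t\<^sub>- = t\<^sub>- e\<close> and \<open>t\<^sub>+ = e t\<^sub>+\<close>, the coefficient
  may be replaced by \<open>e r e = \<phi> s\<close>; then
  \<open>\<phi> s t\<^sub>+ = t\<^sub>+ s\<close>, and \<open>t\<^sub>- t\<^sub>+ = 1\<close> leaves
  \<open>s\<close>.\<close>

lemma tm_\<rho>_tp:
  assumes "r \<in> carrier R"
  shows "\<exists>s \<in> carrier R. tm \<otimes>\<^bsub>S\<^esub> \<rho> r \<otimes>\<^bsub>S\<^esub> tp = \<rho> s"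
proof -
  obtain s where s: "s \<in> carrier R" "\<phi> s = e \<otimes>\<^bsub>R\<^esub> r \<otimes>\<^bsub>R\<^esub> e" using \<phi>_corner[OF assms] by blast
  have "tm \<otimes>\<^bsub>S\<^esub> \<rho> r \<otimes>\<^bsub>S\<^esub> tp = (tm \<otimes>\<^bsub>S\<^esub> tp) \<otimes>\<^bsub>S\<^esub> (tm \<otimes>\<^bsub>S\<^esub> \<rho> r \<otimes>\<^bsub>S\<^esub> tp) \<otimes>\<^bsub>S\<^esub> (tm \<otimes>\<^bsub>S\<^esub> tp)"
    using assms by (simp add: tm_tp)
  also have "\<dots> = tm \<otimes>\<^bsub>S\<^esub> ((tp \<otimes>\<^bsub>S\<^esub> tm) \<otimes>\<^bsub>S\<^esub> \<rho> r \<otimes>\<^bsub>S\<^esub> (tp \<otimes>\<^bsub>S\<^esub> tm)) \<otimes>\<^bsub>S\<^esub> tp"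
    using assms by (simp only: S.m_assoc S.m_closed t_closed \<rho>_closed)
  also have "\<dots> = tm \<otimes>\<^bsub>S\<^esub> (\<rho> (\<phi> s) \<otimes>\<^bsub>S\<^esub> tp)"
    using assms e by (simp add: tp_tm s(2) \<rho>_mult S.m_assoc)
  also have "\<dots> = (tm \<otimes>\<^bsub>S\<^esub> tp) \<otimes>\<^bsub>S\<^esub> \<rho> s"
    using s(1) by (simp add: S.m_assoc flip: tp_\<rho>)
  finally show ?thesis using s(1) by (auto simp: tm_tp)
qed

lemma spanned_nonneg: "spanned (int k) = {\<rho> r \<otimes>\<^bsub>S\<^esub> tp [^]\<^bsub>S\<^esub> k | r. r \<in> carrier R}"
  unfolding spanned_def by (simp only: nat_int of_nat_0_le_iff if_True)

text \<open>The definition puts degree 0 into the branch with \<open>tp\<close>. There both powers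
  are 1, so this description holds for \<open>k = 0\<close> as well.\<close>

lemma spanned_nonpos: "spanned (- int k) = {tm [^]\<^bsub>S\<^esub> k \<otimes>\<^bsub>S\<^esub> \<rho> r | r. r \<in> carrier R}"
proof (cases k)
  case 0
  have "\<rho> r \<otimes>\<^bsub>S\<^esub> tp [^]\<^bsub>S\<^esub> (0::nat) = tm [^]\<^bsub>S\<^esub> (0::nat) \<otimes>\<^bsub>S\<^esub> \<rho> r" if "r \<in> carrier R" for r
    using that by simp
  then have "spanned (int 0) = {tm [^]\<^bsub>S\<^esub> (0::nat) \<otimes>\<^bsub>S\<^esub> \<rho> r | r. r \<in> carrier R}"
    unfolding spanned_nonneg by (intro Collect_cong ex_cong1) metis
  then show ?thesis using 0 by simp
next
  case (Suc j)
  then have "\<not> 0 \<le> - int k" "nat (- (- int k)) = k" by simp_all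
  then show ?thesis unfolding spanned_def by (simp only: if_False)
qed

section \<open>Stability of the spans under left multiplication by generators\<close>

lemma spanned_\<rho>_mult:
  assumes "z \<in> spanned n" "r \<in> carrier R"
  shows "\<rho> r \<otimes>\<^bsub>S\<^esub> z \<in> spanned n"
proof (cases n rule: int_cases2)
  case (nonneg k)
  then obtain s where s: "s \<in> carrier R" "z = \<rho> s \<otimes>\<^bsub>S\<^esub> tp [^]\<^bsub>S\<^esub> k"
    using assms(1) by (auto simp: spanned_nonneg)
  then have "\<rho> r \<otimes>\<^bsub>S\<^esub> z = \<rho> (r \<otimes>\<^bsub>R\<^esub> s) \<otimes>\<^bsub>S\<^esub> tp [^]\<^bsub>S\<^esub> k"
    using assms(2) by (simp add: \<rho>_mult S.m_assoc)
  then show ?thesis using nonneg s(1) assms(2) by (auto simp: spanned_nonneg)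
next
  case (nonpos k)
  then obtain s where s: "s \<in> carrier R" "z = tm [^]\<^bsub>S\<^esub> k \<otimes>\<^bsub>S\<^esub> \<rho> s"
    using assms(1) by (auto simp: spanned_nonpos)
  then have "\<rho> r \<otimes>\<^bsub>S\<^esub> z = (\<rho> r \<otimes>\<^bsub>S\<^esub> tm [^]\<^bsub>S\<^esub> k) \<otimes>\<^bsub>S\<^esub> \<rho> s"
    using assms(2) by (simp add: S.m_assoc)
  also have "\<dots> = tm [^]\<^bsub>S\<^esub> k \<otimes>\<^bsub>S\<^esub> \<rho> ((\<phi> ^^ k) r \<otimes>\<^bsub>R\<^esub> s)"
    using assms(2) s(1) by (simp add: \<rho>_tm_pow \<phi>_pow_closed \<rho>_mult S.m_assoc)
  finally show ?thesis
    using nonpos s(1) \<phi>_pow_closed[OF assms(2)] by (auto simp: spanned_nonpos)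
qed

text \<open>For negative \<open>n\<close> one pair \<open>t\<^sub>+ t\<^sub>-\<close> becomes
  \<open>e\<close>, which moves to the right through the remaining \<open>t\<^sub>-\<close> as
  \<open>(\<phi> ^^ k) e\<close> and joins the coefficient.\<close>

lemma spanned_tp_mult:
  assumes "z \<in> spanned n"
  shows "tp \<otimes>\<^bsub>S\<^esub> z \<in> spanned (n + 1)"
proof (cases "0 \<le> n")
  case True
  then obtain k where n: "n = int k" by (rule nonneg_int_cases)
  then have n1: "n + 1 = int (Suc k)" by simp
  obtain s where s: "s \<in> carrier R" "z = \<rho> s \<otimes>\<^bsub>S\<^esub> tp [^]\<^bsub>S\<^esub> k"
    using assms n by (auto simp: spanned_nonneg)
  then have "tp \<otimes>\<^bsub>S\<^esub> z = \<rho> (\<phi> s) \<otimes>\<^bsub>S\<^esub> tp [^]\<^bsub>S\<^esub> Suc k"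
    using tp_\<rho>[OF s(1)] \<phi>_closed[OF s(1)] unfolding tp_pow_Suc by (simp flip: S.m_assoc)
  then show ?thesis
    unfolding n1 spanned_nonneg using \<phi>_closed[OF s(1)] by blast
next
  case False
  then obtain k where n: "n = - int (Suc k)" by (metis negD not_le)
  then have n1: "n + 1 = - int k" by simp
  obtain s where s: "s \<in> carrier R" "z = tm [^]\<^bsub>S\<^esub> Suc k \<otimes>\<^bsub>S\<^esub> \<rho> s"
    using assms unfolding n spanned_nonpos by blast
  have "tp \<otimes>\<^bsub>S\<^esub> z = (tp \<otimes>\<^bsub>S\<^esub> tm) \<otimes>\<^bsub>S\<^esub> tm [^]\<^bsub>S\<^esub> k \<otimes>\<^bsub>S\<^esub> \<rho> s"
    using s unfolding tm_pow_Suc by (simp add: S.m_assoc)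
  also have "\<dots> = tm [^]\<^bsub>S\<^esub> k \<otimes>\<^bsub>S\<^esub> \<rho> ((\<phi> ^^ k) e \<otimes>\<^bsub>R\<^esub> s)"
    using e s(1) by (simp add: tp_tm \<rho>_tm_pow \<phi>_pow_closed \<rho>_mult S.m_assoc)
  finally show ?thesis
    unfolding n1 spanned_nonpos using s(1) \<phi>_pow_closed[OF e, of k] by blast
qed

text \<open>For positive \<open>n\<close> the new factor meets one \<open>t\<^sub>+\<close> across
  the coefficient, and \<open>tm_\<rho>_tp\<close> turns that triple into a single
  coefficient.\<close>

lemma spanned_tm_mult:
  assumes "z \<in> spanned n"
  shows "tm \<otimes>\<^bsub>S\<^esub> z \<in> spanned (n - 1)"
proof (cases "0 < n")
  case True
  then obtain k where n: "n = int (Suc k)" by (metis pos_int_cases gr0_implies_Suc)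
  then have n1: "n - 1 = int k" by simp
  obtain s where s: "s \<in> carrier R" "z = \<rho> s \<otimes>\<^bsub>S\<^esub> tp [^]\<^bsub>S\<^esub> Suc k"
    using assms unfolding n spanned_nonneg by blast
  obtain r where r: "r \<in> carrier R" "tm \<otimes>\<^bsub>S\<^esub> \<rho> s \<otimes>\<^bsub>S\<^esub> tp = \<rho> r" using tm_\<rho>_tp[OF s(1)] by blast
  have "tm \<otimes>\<^bsub>S\<^esub> z = (tm \<otimes>\<^bsub>S\<^esub> \<rho> s \<otimes>\<^bsub>S\<^esub> tp) \<otimes>\<^bsub>S\<^esub> tp [^]\<^bsub>S\<^esub> k"
    using s unfolding tp_pow_Suc by (simp add: S.m_assoc)
  then show ?thesis unfolding n1 spanned_nonneg r(2) using r(1) by blast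
next
  case False
  then obtain k where n: "n = - int k" by (metis nonpos_int_cases not_less)
  then have n1: "n - 1 = - int (Suc k)" by simp
  obtain s where s: "s \<in> carrier R" "z = tm [^]\<^bsub>S\<^esub> k \<otimes>\<^bsub>S\<^esub> \<rho> s"
    using assms unfolding n spanned_nonpos by blast
  have "tm \<otimes>\<^bsub>S\<^esub> z = tm [^]\<^bsub>S\<^esub> Suc k \<otimes>\<^bsub>S\<^esub> \<rho> s"
    using s unfolding tm_pow_Suc by (simp add: S.m_assoc)
  then show ?thesis unfolding n1 spanned_nonpos using s(1) by blast
qed

lemma spanned_one: "\<one>\<^bsub>S\<^esub> \<in> spanned 0"
proof -
  have "\<one>\<^bsub>S\<^esub> = \<rho> \<one>\<^bsub>R\<^esub> \<otimes>\<^bsub>S\<^esub> tp [^]\<^bsub>S\<^esub> (0 :: nat)" by (simp add: \<rho>_one)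
  then have "\<one>\<^bsub>S\<^esub> \<in> spanned (int 0)" unfolding spanned_nonneg using R.one_closed by blast
  then show ?thesis by simp
qed

lemma spanned_diff:
  assumes "y \<in> spanned n" "z \<in> spanned n"
  shows "y \<ominus>\<^bsub>S\<^esub> z \<in> spanned n"
proof (cases n rule: int_cases2)
  case (nonneg k)
  then obtain r s where rs: "r \<in> carrier R" "y = \<rho> r \<otimes>\<^bsub>S\<^esub> tp [^]\<^bsub>S\<^esub> k"
    "s \<in> carrier R" "z = \<rho> s \<otimes>\<^bsub>S\<^esub> tp [^]\<^bsub>S\<^esub> k"
    using assms by (auto simp: spanned_nonneg)
  then have "y \<ominus>\<^bsub>S\<^esub> z = (\<rho> r \<ominus>\<^bsub>S\<^esub> \<rho> s) \<otimes>\<^bsub>S\<^esub> tp [^]\<^bsub>S\<^esub> k"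
    by (simp add: S.l_distr S.l_minus S.minus_eq)
  also have "\<dots> = \<rho> (r \<ominus>\<^bsub>R\<^esub> s) \<otimes>\<^bsub>S\<^esub> tp [^]\<^bsub>S\<^esub> k"
    by (simp only: \<rho>_diff[OF rs(1,3)])
  finally show ?thesis
    unfolding nonneg spanned_nonneg using R.minus_closed[OF rs(1,3)] by blast
next
  case (nonpos k)
  then obtain r s where rs: "r \<in> carrier R" "y = tm [^]\<^bsub>S\<^esub> k \<otimes>\<^bsub>S\<^esub> \<rho> r"
    "s \<in> carrier R" "z = tm [^]\<^bsub>S\<^esub> k \<otimes>\<^bsub>S\<^esub> \<rho> s"
    using assms by (auto simp: spanned_nonpos)
  then have "y \<ominus>\<^bsub>S\<^esub> z = tm [^]\<^bsub>S\<^esub> k \<otimes>\<^bsub>S\<^esub> (\<rho> r \<ominus>\<^bsub>S\<^esub> \<rho> s)"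
    by (simp add: S.r_distr S.r_minus S.minus_eq)
  also have "\<dots> = tm [^]\<^bsub>S\<^esub> k \<otimes>\<^bsub>S\<^esub> \<rho> (r \<ominus>\<^bsub>R\<^esub> s)"
    by (simp only: \<rho>_diff[OF rs(1,3)])
  finally show ?thesis
    unfolding nonpos spanned_nonpos using R.minus_closed[OF rs(1,3)] by blast
qed

lemma spanned_zero: "\<zero>\<^bsub>S\<^esub> \<in> spanned n"
proof (cases n rule: int_cases2)
  case (nonneg k)
  have "\<zero>\<^bsub>S\<^esub> = \<rho> \<zero>\<^bsub>R\<^esub> \<otimes>\<^bsub>S\<^esub> tp [^]\<^bsub>S\<^esub> k"
    using ring_hom_zero[OF \<rho> R.ring_axioms S.ring_axioms] by simp
  then show ?thesis unfolding nonneg spanned_nonneg using R.zero_closed by blast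
next
  case (nonpos k)
  have "\<zero>\<^bsub>S\<^esub> = tm [^]\<^bsub>S\<^esub> k \<otimes>\<^bsub>S\<^esub> \<rho> \<zero>\<^bsub>R\<^esub>"
    using ring_hom_zero[OF \<rho> R.ring_axioms S.ring_axioms] by simp
  then show ?thesis unfolding nonpos spanned_nonpos using R.zero_closed by blast
qed

section \<open>Regularity of the spans\<close>

lemma tm_tp_pow: "tm [^]\<^bsub>S\<^esub> (k :: nat) \<otimes>\<^bsub>S\<^esub> tp [^]\<^bsub>S\<^esub> k = \<one>\<^bsub>S\<^esub>"
proof (induction k)
  case (Suc k)
  have "tm [^]\<^bsub>S\<^esub> Suc k \<otimes>\<^bsub>S\<^esub> tp [^]\<^bsub>S\<^esub> Suc k = tm [^]\<^bsub>S\<^esub> k \<otimes>\<^bsub>S\<^esub> (tm \<otimes>\<^bsub>S\<^esub> tp) \<otimes>\<^bsub>S\<^esub> tp [^]\<^bsub>S\<^esub> k"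
    unfolding tp_pow_Suc by (simp add: S.m_assoc)
  then show ?case using Suc by (simp add: tm_tp)
qed simp

text \<open>Wrapping one more \<open>t\<^sub>+\<close> and \<open>t\<^sub>-\<close> around a
  coefficient \<open>q\<close> gives the coefficient \<open>\<phi> q e\<close>.\<close>

lemma tp_tm_pow: "\<exists>q \<in> carrier R. tp [^]\<^bsub>S\<^esub> (k :: nat) \<otimes>\<^bsub>S\<^esub> tm [^]\<^bsub>S\<^esub> k = \<rho> q"
proof (induction k)
  case 0
  show ?case using \<rho>_one R.one_closed by (intro bexI[of _ "\<one>\<^bsub>R\<^esub>"]) simp_all
next
  case (Suc k)
  then obtain q where q: "q \<in> carrier R" "tp [^]\<^bsub>S\<^esub> k \<otimes>\<^bsub>S\<^esub> tm [^]\<^bsub>S\<^esub> k = \<rho> q" by blast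
  have "tp [^]\<^bsub>S\<^esub> Suc k \<otimes>\<^bsub>S\<^esub> tm [^]\<^bsub>S\<^esub> Suc k = tp \<otimes>\<^bsub>S\<^esub> (tp [^]\<^bsub>S\<^esub> k \<otimes>\<^bsub>S\<^esub> tm [^]\<^bsub>S\<^esub> k) \<otimes>\<^bsub>S\<^esub> tm"
    unfolding tp_pow_Suc by (simp add: S.m_assoc)
  also have "\<dots> = \<rho> (\<phi> q) \<otimes>\<^bsub>S\<^esub> (tp \<otimes>\<^bsub>S\<^esub> tm)"
    using q \<phi>_closed[OF q(1)] by (simp add: tp_\<rho> S.m_assoc)
  also have "\<dots> = \<rho> (\<phi> q \<otimes>\<^bsub>R\<^esub> e)" using \<phi>_closed[OF q(1)] e by (simp add: tp_tm \<rho>_mult)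
  finally show ?case using \<phi>_closed[OF q(1)] e by blast
qed

text \<open>The powers of \<open>tp\<close> and \<open>tm\<close> are quasi-inverse to each other,
  so the problem reduces to a quasi-inverse of the coefficient in \<open>R\<close>, placed next to
  the opposite power.\<close>

lemma spanned_regular:
  assumes regular: "von_neumann_regular R" and z: "z \<in> spanned n"
  shows "\<exists>y \<in> spanned (- n). z \<otimes>\<^bsub>S\<^esub> y \<otimes>\<^bsub>S\<^esub> z = z"
proof -
  obtain k :: nat where n: "n = int k \<or> n = - int k" by (metis int_cases2)
  let ?p = "tp [^]\<^bsub>S\<^esub> k" and ?m = "tm [^]\<^bsub>S\<^esub> k"
  have pm: "?p \<in> carrier S" "?m \<in> carrier S" by simp_all
  obtain q where q: "q \<in> carrier R" "?p \<otimes>\<^bsub>S\<^esub> ?m = \<rho> q" using tp_tm_pow by blast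
  have qp: "\<rho> q \<otimes>\<^bsub>S\<^esub> ?p = ?p" using pm by (simp add: tm_tp_pow S.m_assoc flip: q(2))
  have mq: "?m \<otimes>\<^bsub>S\<^esub> \<rho> q = ?m"
  proof -
    have "?m \<otimes>\<^bsub>S\<^esub> \<rho> q = (?m \<otimes>\<^bsub>S\<^esub> ?p) \<otimes>\<^bsub>S\<^esub> ?m" using pm by (simp add: S.m_assoc flip: q(2))
    then show ?thesis using pm by (simp add: tm_tp_pow)
  qed
  have inv: "\<exists>b \<in> carrier R. \<rho> a \<otimes>\<^bsub>S\<^esub> \<rho> b \<otimes>\<^bsub>S\<^esub> \<rho> a = \<rho> a" if "a \<in> carrier R" for a
    using regular that unfolding von_neumann_regular_def
    by (metis \<rho>_mult R.m_closed)
  have qq: "\<rho> q \<otimes>\<^bsub>S\<^esub> \<rho> q = \<rho> q"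
    using pm q(1) qp by (metis q(2) S.m_assoc \<rho>_closed)
  from n show ?thesis
  proof
    assume n: "n = int k"
    obtain r where r: "r \<in> carrier R" "z = \<rho> r \<otimes>\<^bsub>S\<^esub> ?p"
      using z unfolding n spanned_nonneg by blast
    \<comment> \<open>As \<open>\<rho> q\<close> fixes the power of \<open>tp\<close>, the
      coefficient \<open>r\<close> may be replaced by \<open>r q\<close>, which absorbs the
      idempotent \<open>\<rho> q\<close> that arises in the middle of \<open>z y z\<close>. The
      nonpositive case below is the mirror image.\<close>
    let ?a = "r \<otimes>\<^bsub>R\<^esub> q"
    have a: "?a \<in> carrier R" using r q by simp
    then obtain b where b: "b \<in> carrier R" "\<rho> ?a \<otimes>\<^bsub>S\<^esub> \<rho> b \<otimes>\<^bsub>S\<^esub> \<rho> ?a = \<rho> ?a" using inv by blast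
    have za: "z = \<rho> ?a \<otimes>\<^bsub>S\<^esub> ?p" using r q(1) qp pm by (simp add: \<rho>_mult S.m_assoc)
    have aq: "\<rho> ?a \<otimes>\<^bsub>S\<^esub> \<rho> q = \<rho> ?a" using r q(1) qq by (simp add: \<rho>_mult S.m_assoc)
    let ?y = "?m \<otimes>\<^bsub>S\<^esub> \<rho> b"
    have "z \<otimes>\<^bsub>S\<^esub> ?y \<otimes>\<^bsub>S\<^esub> z = (\<rho> ?a \<otimes>\<^bsub>S\<^esub> (?p \<otimes>\<^bsub>S\<^esub> ?m)) \<otimes>\<^bsub>S\<^esub> \<rho> b \<otimes>\<^bsub>S\<^esub> \<rho> ?a \<otimes>\<^bsub>S\<^esub> ?p"
      using \<rho>_closed[OF a] \<rho>_closed[OF b(1)] pm by (simp add: za S.m_assoc)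
    also have "\<dots> = z" by (simp only: q(2) aq b(2) za)
    finally have "z \<otimes>\<^bsub>S\<^esub> ?y \<otimes>\<^bsub>S\<^esub> z = z" .
    moreover have "?y \<in> spanned (- n)" unfolding n spanned_nonpos using b(1) by blast
    ultimately show ?thesis by blast
  next
    assume n: "n = - int k"
    obtain r where r: "r \<in> carrier R" "z = ?m \<otimes>\<^bsub>S\<^esub> \<rho> r"
      using z unfolding n spanned_nonpos by blast
    let ?a = "q \<otimes>\<^bsub>R\<^esub> r"
    have a: "?a \<in> carrier R" using r q by simp
    then obtain b where b: "b \<in> carrier R" "\<rho> ?a \<otimes>\<^bsub>S\<^esub> \<rho> b \<otimes>\<^bsub>S\<^esub> \<rho> ?a = \<rho> ?a" using inv by blast
    have za: "z = ?m \<otimes>\<^bsub>S\<^esub> \<rho> ?a" using r q(1) mq pm by (simp add: \<rho>_mult flip: S.m_assoc)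
    have qa: "\<rho> q \<otimes>\<^bsub>S\<^esub> \<rho> ?a = \<rho> ?a" using r q(1) qq by (simp add: \<rho>_mult flip: S.m_assoc)
    let ?y = "\<rho> b \<otimes>\<^bsub>S\<^esub> ?p"
    have "z \<otimes>\<^bsub>S\<^esub> ?y \<otimes>\<^bsub>S\<^esub> z = ?m \<otimes>\<^bsub>S\<^esub> (\<rho> ?a \<otimes>\<^bsub>S\<^esub> \<rho> b \<otimes>\<^bsub>S\<^esub> ((?p \<otimes>\<^bsub>S\<^esub> ?m) \<otimes>\<^bsub>S\<^esub> \<rho> ?a))"
      using \<rho>_closed[OF a] \<rho>_closed[OF b(1)] pm by (simp add: za S.m_assoc)
    also have "\<dots> = z" by (simp only: q(2) qa b(2) za)
    finally have "z \<otimes>\<^bsub>S\<^esub> ?y \<otimes>\<^bsub>S\<^esub> z = z" .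
    moreover have "?y \<in> spanned (- n)" unfolding n minus_minus spanned_nonneg using b(1) by blast
    ultimately show ?thesis by blast
  qed
qed

end

section \<open>The grading of the presented ring and its homogeneous components\<close>

fun gen_degree :: "'a skew_gen \<Rightarrow> int" where
  "gen_degree (Coeff r) = 0"
| "gen_degree T_plus = 1"
| "gen_degree T_minus = - 1"

lemma skew_relators_homogeneous:
  assumes "p \<in> skew_relators R e \<phi>"
  shows "\<exists>d. homogeneous_poly gen_degree d p"
proof -
  let ?h = "homogeneous_poly gen_degree"
  let ?c = "\<lambda>r. free_gen (Coeff r)" and ?tp = "free_gen T_plus" and ?tm = "free_gen T_minus"
  have c: "?h 0 (?c r)" for r :: 'a using homogeneous_poly_free_gen[of gen_degree "Coeff r"] by simp
  have tp: "?h 1 ?tp" and tm: "?h (- 1) ?tm"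
    using homogeneous_poly_free_gen[of gen_degree T_plus] homogeneous_poly_free_gen[of gen_degree T_minus]
    by simp_all
  note mult = homogeneous_poly_mult[where \<delta> = gen_degree]
  consider a b where "p = ?c (a \<oplus>\<^bsub>R\<^esub> b) - (?c a + ?c b)"
    | a b where "p = ?c (a \<otimes>\<^bsub>R\<^esub> b) - ?c a * ?c b"
    | "p = ?c \<one>\<^bsub>R\<^esub> - 1" | "p = ?tm * ?tp - 1" | "p = ?tp * ?tm - ?c e"
    | r where "p = ?tp * ?c r - ?c (\<phi> r) * ?tp"
    | r where "p = ?c r * ?tm - ?tm * ?c (\<phi> r)"
    using assms unfolding skew_relators_def Let_def by blast
  then show ?thesis
  proof cases
    case (1 a b)
    then have "?h 0 p" by (auto intro: homogeneous_poly_diff homogeneous_poly_add c)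
    then show ?thesis ..
  next
    case (2 a b)
    then have "?h 0 p" using mult[OF c c, of a b] by (auto intro: homogeneous_poly_diff c)
    then show ?thesis ..
  next
    case 3
    then have "?h 0 p" by (auto intro: homogeneous_poly_diff homogeneous_poly_one c)
    then show ?thesis ..
  next
    case 4
    then have "?h 0 p" using mult[OF tm tp] by (auto intro: homogeneous_poly_diff homogeneous_poly_one)
    then show ?thesis ..
  next
    case 5
    then have "?h 0 p" using mult[OF tp tm] by (auto intro: homogeneous_poly_diff c)
    then show ?thesis ..
  next
    case (6 r)
    then have "?h 1 p" using mult[OF tp c, of r] mult[OF c tp, of "\<phi> r"] by (auto intro: homogeneous_poly_diff)
    then show ?thesis ..
  next
    case (7 r)
    then have "?h (- 1) p" using mult[OF c tm, of r] mult[OF tm c, of "\<phi> r"] by (auto intro: homogeneous_poly_diff)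
    then show ?thesis ..
  qed
qed

locale corner_skew_laurent_ring = R: ring R
  for R :: "('a, 'm) ring_scheme" and e :: 'a and \<phi> :: "'a \<Rightarrow> 'a" +
  assumes e: "e \<in> carrier R"
    and \<phi>: "\<phi> \<in> ring_iso R (corner_ring R e)"
begin

lemma \<phi>_closed: "r \<in> carrier R \<Longrightarrow> \<phi> r \<in> carrier R"
  using ring_iso_memE(1)[OF \<phi>, of r] e by (auto simp: corner_ring_def)

lemma \<phi>_corner:
  assumes "r \<in> carrier R"
  shows "\<exists>s \<in> carrier R. \<phi> s = e \<otimes>\<^bsub>R\<^esub> r \<otimes>\<^bsub>R\<^esub> e"
proof -
  have "e \<otimes>\<^bsub>R\<^esub> r \<otimes>\<^bsub>R\<^esub> e \<in> carrier (corner_ring R e)" using assms by (auto simp: corner_ring_def)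
  also have "\<dots> = \<phi> ` carrier R" using ring_iso_memE(5)[OF \<phi>] by (simp add: bij_betw_def)
  finally show ?thesis by (auto dest: sym)
qed

sublocale graded_presentation "skew_gens R" gen_degree "skew_relators R e \<phi>"
proof
  show "skew_relators R e \<phi> \<subseteq> carrier (free_ring (skew_gens R))"
    using \<phi>_closed by (intro skew_relators_closed R.ring_axioms e) auto
qed (rule skew_relators_homogeneous)

abbreviation coeff where "coeff r \<equiv> cls (free_gen (Coeff r))"
abbreviation t_plus where "t_plus \<equiv> cls (free_gen T_plus)"
abbreviation t_minus where "t_minus \<equiv> cls (free_gen T_minus)"

lemma gen_closed:
  "r \<in> carrier R \<Longrightarrow> free_gen (Coeff r) \<in> carrier F"
  "free_gen T_plus \<in> carrier F" "free_gen T_minus \<in> carrier F"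
  by (auto intro!: free_gen_closed simp: skew_gens_def)

lemma free_closed:
  "1 \<in> carrier F" "p \<in> carrier F \<Longrightarrow> q \<in> carrier F \<Longrightarrow> p + q \<in> carrier F"
  "p \<in> carrier F \<Longrightarrow> q \<in> carrier F \<Longrightarrow> p * q \<in> carrier F"
  using F.one_closed F.a_closed[of p q] F.m_closed[of p q] by simp_all

lemma coeff_hom: "coeff \<in> ring_hom R Q"
proof (rule ring_hom_memI)
  fix a b assume ab: "a \<in> carrier R" "b \<in> carrier R"
  have "free_gen (Coeff (a \<otimes>\<^bsub>R\<^esub> b)) - free_gen (Coeff a) * free_gen (Coeff b) \<in> skew_relators R e \<phi>"
    using ab unfolding skew_relators_def Let_def by blast
  then show "coeff (a \<otimes>\<^bsub>R\<^esub> b) = coeff a \<otimes>\<^bsub>Q\<^esub> coeff b"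
    using cls_relator ab by (simp add: gen_closed free_closed flip: cls_mult)
  have "free_gen (Coeff (a \<oplus>\<^bsub>R\<^esub> b)) - (free_gen (Coeff a) + free_gen (Coeff b)) \<in> skew_relators R e \<phi>"
    using ab unfolding skew_relators_def Let_def by blast
  then show "coeff (a \<oplus>\<^bsub>R\<^esub> b) = coeff a \<oplus>\<^bsub>Q\<^esub> coeff b"
    using cls_relator ab by (simp add: gen_closed free_closed flip: cls_add)
next
  have "free_gen (Coeff \<one>\<^bsub>R\<^esub>) - 1 \<in> skew_relators R e \<phi>"
    unfolding skew_relators_def Let_def by blast
  then show "coeff \<one>\<^bsub>R\<^esub> = \<one>\<^bsub>Q\<^esub>" using cls_relator by (simp add: gen_closed free_closed flip: cls_one)
qed (simp add: cls_closed gen_closed)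

sublocale corner_skew_relations R Q e \<phi> coeff t_plus t_minus
proof
  have "free_gen T_minus * free_gen T_plus - 1 \<in> skew_relators R e \<phi>"
    unfolding skew_relators_def Let_def by blast
  then show "t_minus \<otimes>\<^bsub>Q\<^esub> t_plus = \<one>\<^bsub>Q\<^esub>"
    using cls_relator by (simp add: gen_closed free_closed flip: cls_mult cls_one)
  have "free_gen T_plus * free_gen T_minus - free_gen (Coeff e) \<in> skew_relators R e \<phi>"
    unfolding skew_relators_def Let_def by blast
  then show "t_plus \<otimes>\<^bsub>Q\<^esub> t_minus = coeff e"
    using cls_relator e by (simp add: gen_closed free_closed flip: cls_mult)
next
  fix r assume r: "r \<in> carrier R"
  have "free_gen T_plus * free_gen (Coeff r) - free_gen (Coeff (\<phi> r)) * free_gen T_plus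
      \<in> skew_relators R e \<phi>"
    using r unfolding skew_relators_def Let_def by blast
  then show "t_plus \<otimes>\<^bsub>Q\<^esub> coeff r = coeff (\<phi> r) \<otimes>\<^bsub>Q\<^esub> t_plus"
    using cls_relator r by (simp add: gen_closed free_closed \<phi>_closed flip: cls_mult)
  have "free_gen (Coeff r) * free_gen T_minus - free_gen T_minus * free_gen (Coeff (\<phi> r))
      \<in> skew_relators R e \<phi>"
    using r unfolding skew_relators_def Let_def by blast
  then show "coeff r \<otimes>\<^bsub>Q\<^esub> t_minus = t_minus \<otimes>\<^bsub>Q\<^esub> coeff (\<phi> r)"
    using cls_relator r by (simp add: gen_closed free_closed \<phi>_closed flip: cls_mult)
qed (simp_all add: e \<phi>_closed \<phi>_corner coeff_hom cls_closed gen_closed)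

text \<open>Induction on the word: the first letter multiplies the class of the remaining word from
  the left, which is why only left multiplication by generators was studied.\<close>

lemma word_spanned:
  "set ls \<subseteq> skew_gens R \<Longrightarrow>
    cls (Poly_Mapping.single (Word ls) 1) \<in> spanned (sum_list (map gen_degree ls))"
proof (induction ls)
  case Nil
  have "Poly_Mapping.single (Word []) 1 = (1 :: 'a skew_gen fmonoid \<Rightarrow>\<^sub>0 int)"
    by (simp flip: zero_fmonoid_def)
  then show ?case using spanned_one by (simp add: cls_one)
next
  case (Cons x ls)
  let ?p = "Poly_Mapping.single (Word ls) 1"
  have p: "?p \<in> carrier F" using Cons.prems by (simp add: free_ring_def)
  have x: "free_gen x \<in> carrier F" using Cons.prems by (intro free_gen_closed) simp
  have "Poly_Mapping.single (Word (x # ls)) 1 = free_gen x * ?p"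
    by (simp add: free_gen_def mult_single plus_fmonoid_def)
  then have eq: "cls (Poly_Mapping.single (Word (x # ls)) 1) = cls (free_gen x) \<otimes>\<^bsub>Q\<^esub> cls ?p"
    using p x by (simp add: cls_mult)
  have IH: "cls ?p \<in> spanned (sum_list (map gen_degree ls))" using Cons by simp
  show ?case
    unfolding eq
    using Cons.prems spanned_\<rho>_mult[OF IH] spanned_tp_mult[OF IH] spanned_tm_mult[OF IH]
    by (cases x) (auto simp: skew_gens_def add.commute)
qed

lemma homogeneous_spanned:
  assumes "homogeneous n Z"
  shows "Z \<in> spanned n"
  using assms
proof (rule homogeneous_induct)
  show "cls (Poly_Mapping.single w 1) \<in> spanned n"
    if "set (letters w) \<subseteq> skew_gens R" "word_degree gen_degree w = n" for w
    using that word_spanned[of "letters w"] by (simp add: word_degree_def)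
qed (rule spanned_zero, rule spanned_diff)

text \<open>This converse of \<open>homogeneous_spanned\<close> makes the quasi-inverses found in
  \<open>spanned (- n)\<close> homogeneous of degree \<open>- n\<close>, as
  \<open>semiprimitive_if_graded_regular\<close> demands.\<close>

lemma spanned_homogeneous:
  assumes "Z \<in> spanned n"
  shows "homogeneous n Z"
proof -
  have deg: "homogeneous (gen_degree x) (cls (free_gen x))" if "x \<in> skew_gens R" for x
    using that by (intro homogeneous_cls free_gen_closed homogeneous_poly_free_gen)
  have c: "homogeneous 0 (coeff r)" if "r \<in> carrier R" for r
    using deg[of "Coeff r"] that by (simp add: skew_gens_def)
  have tp: "homogeneous 1 t_plus" and tm: "homogeneous (- 1) t_minus"
    using deg[of T_plus] deg[of T_minus] by (simp_all add: skew_gens_def)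
  have one: "homogeneous 0 \<one>\<^bsub>Q\<^esub>" using c[OF R.one_closed] by (simp add: \<rho>_one)
  have p: "homogeneous (int k) (t_plus [^]\<^bsub>Q\<^esub> k)" for k :: nat
  proof (induction k)
    case (Suc k)
    have "int (Suc k) = int k + 1" by simp
    then show ?case using homogeneous_mult[OF Suc tp] by (simp only: Q.nat_pow_Suc)
  qed (simp add: one)
  have m: "homogeneous (- int k) (t_minus [^]\<^bsub>Q\<^esub> k)" for k :: nat
  proof (induction k)
    case (Suc k)
    have "- int (Suc k) = - int k + - 1" by simp
    then show ?case using homogeneous_mult[OF Suc tm] by (simp only: Q.nat_pow_Suc)
  qed (simp add: one)
  show ?thesis
  proof (cases n rule: int_cases2)
    case (nonneg k)
    then obtain r where "r \<in> carrier R" "Z = coeff r \<otimes>\<^bsub>Q\<^esub> t_plus [^]\<^bsub>Q\<^esub> k"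
      using assms unfolding nonneg spanned_nonneg by blast
    then show ?thesis using homogeneous_mult[OF c p] nonneg by simp
  next
    case (nonpos k)
    then obtain r where "r \<in> carrier R" "Z = t_minus [^]\<^bsub>Q\<^esub> k \<otimes>\<^bsub>Q\<^esub> coeff r"
      using assms unfolding nonpos spanned_nonpos by blast
    then show ?thesis using homogeneous_mult[OF m c] nonpos by simp
  qed
qed

lemma semiprimitive:
  assumes "von_neumann_regular R"
  shows "semiprimitive_ring Q"
proof (rule semiprimitive_if_graded_regular)
  fix n Z assume "homogeneous n Z"
  then obtain Y where "Y \<in> spanned (- n)" "Z \<otimes>\<^bsub>Q\<^esub> Y \<otimes>\<^bsub>Q\<^esub> Z = Z"
    using spanned_regular[OF assms homogeneous_spanned] by blast
  then show "\<exists>Y. homogeneous (- n) Y \<and> Z \<otimes>\<^bsub>Q\<^esub> Y \<otimes>\<^bsub>Q\<^esub> Z = Z"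
    using spanned_homogeneous by blast
qed

end

theorem corollary6p3:
  fixes R :: "('a, 'm) ring_scheme" and e :: 'a and \<phi> :: "'a \<Rightarrow> 'a"
  assumes "ring R" and "\<one>\<^bsub>R\<^esub> \<noteq> \<zero>\<^bsub>R\<^esub>"
    and "e \<in> carrier R" and "e \<otimes>\<^bsub>R\<^esub> e = e"
    and "\<phi> \<in> ring_iso R (corner_ring R e)"
    and "von_neumann_regular R"
  shows "semiprimitive_ring (corner_skew_laurent R e \<phi>) \<and>
         semiprime_ring (corner_skew_laurent R e \<phi>)"
proof -
  interpret corner_skew_laurent_ring R e \<phi>
    using assms by (simp add: corner_skew_laurent_ring_def corner_skew_laurent_ring_axioms_def)
  show ?thesis
    unfolding corner_skew_laurent_def
    using semiprimitive[OF assms(6)] Q.semiprime_if_semiprimitive by blast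
qed

end
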